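(* Let $\Omega\subset\mathbb R^n$ be a domain, $M\ge1$, $q_1,\dots,q_M\in(0,1)$, $0<\gamma<\infty$, and let $\sigma_1,\dots,\sigma_M,\omega\in\mathcal M^+(\Omega)$ with $(\sigma_1,\dots,\sigma_M,\omega)\ne(0,\dots,0,0)$. Let $G:\Omega\times\Omega\to(0,+\infty]$ be a positive lower semicontinuous kernel satisfying the weak maximum principle. Consider the integral equation $$(E)\qquad u=\sum_{i=1}^M\mathcal G(u^{q_i}d\sigma_i)+\mathcal G\omega\quad\text{in }\Omega$$ and the conditions $$(A)\quad \mathcal G\sigma_i\in L^{\frac{\gamma+q_i}{1-q_i}}(\Omega,d\sigma_i),\quad i=1,\dots,M,\qquad (B)\quad \mathcal G\omega\in L^{\gamma+q_i}(\Omega,d\sigma_i),\quad i=1,\dots,M.$$ (1) Suppose in addition that $G$ is quasi-symmetric. If $(A)$ and $(B)$ hold, then there exists a positive solution $u$ to $(E)$ with $u\in L^{\gamma+q_i}(\Omega,d\sigma_i)$ for all $i=1,\dots,M$. Moreover, $u$ is minimal in the sense that $u\le v$ in $\Omega$ for any nontrivial supersolution $v$ to $(E)$. (2) Conversely, without the quasi-symmetry assumption on $G$, if there exists a positive supersolution $u$ to $(E)$ with $u\in L^{\gamma+q_i}(\Omega,d\sigma_i)$ for all $i=1,\dots,M$, then $(A)$ and $(B)$ must hold.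
   Context: $\mathcal M^+(\Omega)$ is the set of nonnegative locally finite Borel measures on $\Omega$. For $\mu\in\mathcal M^+(\Omega)$, $\mathcal G\mu(x)=\int_\Omega G(x,y)\,d\mu(y)$, $x\in\Omega$. Weak maximum principle with constant $h\ge1$: for every $\mu\in\mathcal M^+(\Omega)$, if $\mathcal G\mu(x)\le1$ for all $x\in\mathrm{supp}(\mu)$, then $\mathcal G\mu(x)\le h$ for all $x\in\Omega$. The kernel satisfies the weak maximum principle if this holds for some $h\ge 1$. Quasi-symmetry: there is a constant $a>0$ with $a^{-1}G(y,x)\le G(x,y)\le a\,G(y,x)$ for all $x,y\in\Omega$. A solution to $(E)$ is a nonnegative measurable function $u$ on $\Omega$ with $u\in L^{q_i}_{loc}(\Omega,d\sigma_i)$ for all $i$ that satisfies $(E)$ in $\Omega$; it is a supersolution if "$=$" in $(E)$ is replaced by "$\ge$". *)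

theory Defs
  imports "HOL-Analysis.Analysis"
begin

text \<open>Functions and kernels on \<open>\<Omega>\<close> are total functions on the ambient type with values in
  \<open>[0, \<infinity>]\<close>; their values outside \<open>\<Omega>\<close> never matter, because every measure involved
  has underlying space \<open>\<Omega>\<close>.\<close>

definition borel_measures :: "'a::topological_space set \<Rightarrow> 'a measure set"  ("\<M>\<^sup>+") where
  "\<M>\<^sup>+ \<Omega> = {\<mu>. space \<mu> = \<Omega> \<and> sets \<mu> = sets (restrict_space borel \<Omega>) \<and>
     (\<forall>K. compact K \<and> K \<subseteq> \<Omega> \<longrightarrow> emeasure \<mu> K < \<infinity>)}"

definition msupport :: "'a::topological_space measure \<Rightarrow> 'a set" where
  "msupport \<mu> = {x \<in> space \<mu>. \<forall>U. open U \<and> x \<in> U \<longrightarrow> emeasure \<mu> (U \<inter> space \<mu>) > 0}"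

definition lsc_kernel_on ::
    "'a::topological_space set \<Rightarrow> ('a \<Rightarrow> 'a \<Rightarrow> ennreal) \<Rightarrow> bool" where
  "lsc_kernel_on \<Omega> G \<longleftrightarrow>
     (\<forall>c. openin (top_of_set (\<Omega> \<times> \<Omega>)) {(x, y) \<in> \<Omega> \<times> \<Omega>. c < G x y})"

definition potential :: "('a \<Rightarrow> 'a \<Rightarrow> ennreal) \<Rightarrow> 'a measure \<Rightarrow> 'a \<Rightarrow> ennreal" where
  "potential G \<mu> x = (\<integral>\<^sup>+ y. G x y \<partial>\<mu>)"

definition weak_max_principle_const ::
    "'a::topological_space set \<Rightarrow> ('a \<Rightarrow> 'a \<Rightarrow> ennreal) \<Rightarrow> real \<Rightarrow> bool" where
  "weak_max_principle_const \<Omega> G h \<longleftrightarrow>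
     (\<forall>\<mu>\<in>\<M>\<^sup>+ \<Omega>. (\<forall>x\<in>msupport \<mu>. potential G \<mu> x \<le> 1) \<longrightarrow>
                    (\<forall>x\<in>\<Omega>. potential G \<mu> x \<le> ennreal h))"

definition weak_max_principle ::
    "'a::topological_space set \<Rightarrow> ('a \<Rightarrow> 'a \<Rightarrow> ennreal) \<Rightarrow> bool" where
  "weak_max_principle \<Omega> G \<longleftrightarrow> (\<exists>h\<ge>1. weak_max_principle_const \<Omega> G h)"

definition quasi_symmetric :: "'a set \<Rightarrow> ('a \<Rightarrow> 'a \<Rightarrow> ennreal) \<Rightarrow> bool" where
  "quasi_symmetric \<Omega> G \<longleftrightarrow>
     (\<exists>a::real. a > 0 \<and> (\<forall>x\<in>\<Omega>. \<forall>y\<in>\<Omega>.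
        ennreal (inverse a) * G y x \<le> G x y \<and> G x y \<le> ennreal a * G y x))"

text \<open>Only used for exponents \<open>p > 0\<close>, so that \<open>\<infinity>\<close> to the power \<open>p\<close> is \<open>\<infinity>\<close>
  and \<open>0\<close> to the power \<open>p\<close> is \<open>0\<close>.\<close>

definition epowr :: "ennreal \<Rightarrow> real \<Rightarrow> ennreal" where
  "epowr t p = (if t = \<infinity> then \<infinity> else ennreal (enn2real t powr p))"

definition in_Lp :: "real \<Rightarrow> 'a measure \<Rightarrow> ('a \<Rightarrow> ennreal) \<Rightarrow> bool" where
  "in_Lp p \<mu> f \<longleftrightarrow> f \<in> borel_measurable \<mu> \<and> (\<integral>\<^sup>+ x. epowr (f x) p \<partial>\<mu>) < \<infinity>"

definition in_Lp_loc ::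
    "real \<Rightarrow> 'a::topological_space measure \<Rightarrow> ('a \<Rightarrow> ennreal) \<Rightarrow> bool" where
  "in_Lp_loc p \<mu> f \<longleftrightarrow> f \<in> borel_measurable \<mu> \<and>
     (\<forall>K. compact K \<and> K \<subseteq> space \<mu> \<longrightarrow> (\<integral>\<^sup>+ x\<in>K. epowr (f x) p \<partial>\<mu>) < \<infinity>)"

definition eq_rhs :: "('a \<Rightarrow> 'a \<Rightarrow> ennreal) \<Rightarrow> nat \<Rightarrow> (nat \<Rightarrow> real) \<Rightarrow> (nat \<Rightarrow> 'a measure) \<Rightarrow>
    'a measure \<Rightarrow> ('a \<Rightarrow> ennreal) \<Rightarrow> 'a \<Rightarrow> ennreal" where
  "eq_rhs G M q \<sigma> \<omega> u x =
     (\<Sum>i=1..M. potential G (density (\<sigma> i) (\<lambda>y. epowr (u y) (q i))) x) + potential G \<omega> x"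

definition is_solution :: "'a::topological_space set \<Rightarrow> ('a \<Rightarrow> 'a \<Rightarrow> ennreal) \<Rightarrow> nat \<Rightarrow>
    (nat \<Rightarrow> real) \<Rightarrow> (nat \<Rightarrow> 'a measure) \<Rightarrow> 'a measure \<Rightarrow> ('a \<Rightarrow> ennreal) \<Rightarrow> bool" where
  "is_solution \<Omega> G M q \<sigma> \<omega> u \<longleftrightarrow>
     u \<in> borel_measurable (restrict_space borel \<Omega>) \<and>
     (\<forall>i\<in>{1..M}. in_Lp_loc (q i) (\<sigma> i) u) \<and>
     (\<forall>x\<in>\<Omega>. u x = eq_rhs G M q \<sigma> \<omega> u x)"

definition is_supersolution :: "'a::topological_space set \<Rightarrow> ('a \<Rightarrow> 'a \<Rightarrow> ennreal) \<Rightarrow> nat \<Rightarrow>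
    (nat \<Rightarrow> real) \<Rightarrow> (nat \<Rightarrow> 'a measure) \<Rightarrow> 'a measure \<Rightarrow> ('a \<Rightarrow> ennreal) \<Rightarrow> bool" where
  "is_supersolution \<Omega> G M q \<sigma> \<omega> u \<longleftrightarrow>
     u \<in> borel_measurable (restrict_space borel \<Omega>) \<and>
     (\<forall>i\<in>{1..M}. in_Lp_loc (q i) (\<sigma> i) u) \<and>
     (\<forall>x\<in>\<Omega>. u x \<ge> eq_rhs G M q \<sigma> \<omega> u x)"

text \<open>Triviality is understood almost everywhere with respect to the measures of the equation,
  not pointwise: for \<open>\<omega> = 0\<close> and \<open>\<sigma>\<^sub>i\<close> without atoms, the indicator of a single point is a
  supersolution that is not identically zero but is zero in the sense of the equation, and
  no positive solution lies below it.\<close>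

definition nontrivial ::
    "nat \<Rightarrow> (nat \<Rightarrow> 'a measure) \<Rightarrow> 'a measure \<Rightarrow> ('a \<Rightarrow> ennreal) \<Rightarrow> bool" where
  "nontrivial M \<sigma> \<omega> v \<longleftrightarrow>
     \<not> ((\<forall>i\<in>{1..M}. AE x in \<sigma> i. v x = 0) \<and> (AE x in \<omega>. v x = 0))"

end

theory Submission
  imports Defs
begin

text \<open>
  Everything rests on one consequence of the weak maximum principle: restricting a measure \<open>\<nu>\<close> to the
  closed set \<open>{\<G>\<nu> \<le> s}\<close> produces a potential that is at most \<open>h s\<close> on all of \<open>\<Omega>\<close>.

  \<^emph>\<open>Lower bound.\<close> Let \<open>v = \<G>(u\<^sup>q d\<sigma>) \<le> u\<close>. Cutting \<open>{v \<le> t}\<close> into dyadic shells, on which \<open>u\<^sup>q\<close> is bounded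
  below, gives \<open>\<G>\<sigma> \<le> C u\<^bsup>1-q\<^esup>\<close>; this proves (2) and bounds every nontrivial supersolution from below by
  a multiple of \<open>(\<G>\<sigma>)\<^bsup>1/(1-q)\<^esup>\<close>. From that barrier the monotone iteration of (E) increases to the
  minimal solution.

  \<^emph>\<open>Upper bound.\<close> Let \<open>f = \<G>\<mu>\<close>. The part of \<open>\<mu>\<close> on \<open>{f \<le> t/(2h)}\<close> contributes at most half of \<open>f\<close> on
  \<open>{f > t}\<close>, so Fubini and quasi-symmetry yield \<open>t \<nu>{f > t, \<G>\<nu> \<le> s} \<le> 2 a h s \<mu>{f > t/(2h)}\<close>. With
  \<open>\<nu> = \<sigma>\<close> and \<open>s = (t/L)\<^bsup>1-q\<^esup>\<close>, integration over \<open>t\<close> gives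
  \<open>\<integral> f\<^bsup>\<gamma>+q\<^esup> d\<sigma> \<le> L\<^bsup>\<gamma>+q\<^esup> \<integral> (\<G>\<sigma>)\<^bsup>(\<gamma>+q)/(1-q)\<^esup> d\<sigma> + K L\<^bsup>q-1\<^esup> \<integral> f\<^sup>\<gamma> d\<mu>\<close>.
  For \<open>\<mu> = u\<^sup>q d\<sigma>\<close> the last term is absorbed by taking \<open>L\<close> large, which keeps the iteration bounded
  in \<open>L\<^bsup>\<gamma>+q\<^esup>\<close>.
\<close>

section \<open>Powers of extended nonnegative reals\<close>

lemma epowr_top [simp]: "epowr top p = top"
  by (simp add: epowr_def)

lemma epowr_ennreal: "0 \<le> x \<Longrightarrow> epowr (ennreal x) p = ennreal (x powr p)"
  by (simp add: epowr_def)

lemma epowr_0 [simp]: "epowr 0 p = 0"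
  by (simp add: epowr_def)

lemma epowr_one [simp]: "epowr t 1 = t"
  by (cases t) (auto simp: epowr_ennreal)

lemma epowr_mono: "s \<le> t \<Longrightarrow> 0 \<le> p \<Longrightarrow> epowr s p \<le> epowr t p"
  by (cases s; cases t) (auto simp: epowr_ennreal powr_mono2 top_unique)

lemma epowr_epowr: "epowr (epowr t p) s = epowr t (p * s)"
  by (cases t) (auto simp: epowr_ennreal powr_powr)

lemma epowr_add: "epowr t (p + s) = epowr t p * epowr t s"
  by (cases t) (auto simp: epowr_ennreal powr_add ennreal_mult ennreal_top_mult)

lemma epowr_mult: "epowr (s * t) p = epowr s p * epowr t p"
  by (cases s; cases t)
     (auto simp: epowr_ennreal powr_mult ennreal_mult[symmetric] ennreal_top_mult ennreal_mult_top)

lemma epowr_pos_iff [simp]: "0 < epowr t p \<longleftrightarrow> 0 < t"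
  by (cases t) (auto simp: epowr_ennreal)

lemma epowr_le_iff:
  assumes "0 < p"
  shows "epowr t p \<le> s \<longleftrightarrow> t \<le> epowr s (1 / p)"
proof
  assume "epowr t p \<le> s"
  from epowr_mono[OF this, of "1 / p"] show "t \<le> epowr s (1 / p)"
    using assms by (simp add: epowr_epowr)
next
  assume "t \<le> epowr s (1 / p)"
  from epowr_mono[OF this, of p] show "epowr t p \<le> s"
    using assms by (simp add: epowr_epowr)
qed

text \<open>By \<open>epowr_le_iff\<close> the power is left adjoint to the power
  \<open>1 / p\<close>, so both sides have the same upper bounds.\<close>

lemma epowr_SUP:
  assumes "0 < p"
  shows "epowr (SUP i\<in>I. f i) p = (SUP i\<in>I. epowr (f i) p)"
proof -
  have "epowr (SUP i\<in>I. f i) p \<le> c \<longleftrightarrow> (SUP i\<in>I. epowr (f i) p) \<le> c" for c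
    using assms by (simp add: epowr_le_iff SUP_le_iff)
  then show ?thesis
    by (meson order.antisym order.refl)
qed

lemma borel_measurable_epowr [measurable (raw)]:
  assumes [measurable]: "f \<in> borel_measurable M"
  shows "(\<lambda>x. epowr (f x) p) \<in> borel_measurable M"
  unfolding epowr_def by measurable

text \<open>A coarse form of Young's inequality: both factors are at most powers of the larger of
  \<open>a\<close> and \<open>b\<close>. The lost constant is harmless, since a freely chosen factor
  is attached wherever the bound is used.\<close>

lemma epowr_mult_epowr_le:
  assumes "0 \<le> p" "0 \<le> s"
  shows "epowr a p * epowr b s \<le> epowr a (p + s) + epowr b (p + s)"
proof -
  have "epowr a p * epowr b s \<le> epowr (max a b) p * epowr (max a b) s"
    using assms by (intro mult_mono epowr_mono) auto
  also have "\<dots> = epowr (max a b) (p + s)"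
    by (simp add: epowr_add)
  also have "\<dots> \<le> epowr a (p + s) + epowr b (p + s)"
    by (cases "a \<le> b") (auto simp: max_def intro: add_increasing add_increasing2)
  finally show ?thesis .
qed

text \<open>Above 1 the power grows with the exponent; replacing \<open>a\<close> by
  \<open>max a 1\<close> treats all values at once. This passes to a smaller exponent on sets of
  finite measure.\<close>

lemma epowr_le_one_add:
  assumes "0 \<le> p" "p \<le> s"
  shows "epowr a p \<le> 1 + epowr a s"
proof -
  have "epowr a p \<le> epowr (max a 1) p"
    using assms by (intro epowr_mono) auto
  also have "\<dots> \<le> epowr (max a 1) s"
  proof (cases "max a 1")
    case (real x)
    then have "1 \<le> x"
      by (metis ennreal_1 ennreal_le_iff max.cobounded2)
    with real show ?thesis
      using assms by (auto simp: epowr_ennreal intro!: powr_mono)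
  qed simp
  also have "\<dots> \<le> epowr 1 s + epowr a s"
    by (cases "a \<le> 1") (auto simp: max_def intro: add_increasing add_increasing2)
  also have "epowr 1 s = 1"
    using epowr_ennreal[of 1 s] by simp
  finally show ?thesis .
qed

text \<open>Every term is at most the maximum \<open>m\<close>, and the power of \<open>m\<close> is
  one of the terms on the right. Convex and concave powers are treated alike.\<close>

lemma epowr_sum_le:
  assumes "finite I" "0 \<le> p"
  shows "epowr (\<Sum>i\<in>I. f i) p \<le> ennreal (real (card I) powr p) * (\<Sum>i\<in>I. epowr (f i) p)"
proof (cases "I = {}")
  case False
  define m where "m = Max (f ` I)"
  have m: "m \<in> f ` I" "\<And>i. i \<in> I \<Longrightarrow> f i \<le> m"
    using assms False by (auto simp: m_def intro!: Max_in)
  have "(\<Sum>i\<in>I. f i) \<le> of_nat (card I) * m"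
    using m sum_bounded_above[of I f m] by simp
  also have "\<dots> = ennreal (real (card I)) * m"
    by (simp add: ennreal_of_nat_eq_real_of_nat)
  finally have "epowr (\<Sum>i\<in>I. f i) p \<le> epowr (ennreal (real (card I)) * m) p"
    using assms by (intro epowr_mono)
  also have "\<dots> = ennreal (real (card I) powr p) * epowr m p"
    by (simp add: epowr_mult epowr_ennreal)
  also have "epowr m p \<le> (\<Sum>i\<in>I. epowr (f i) p)"
    using m assms by (auto intro!: member_le_sum)
  finally show ?thesis
    by (meson mult_left_mono order_trans zero_le)
qed simp

lemma epowr_add_le:
  assumes "0 \<le> p"
  shows "epowr (a + b) p \<le> ennreal (2 powr p) * (epowr a p + epowr b p)"
  using epowr_sum_le[of "UNIV :: bool set" p "\<lambda>i. if i then a else b"] assms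
  by (simp add: UNIV_bool add.commute)

section \<open>Layer-cake formulas and elementary tools\<close>

text \<open>The derivative of t^p is integrated from 0 to \<open>f\<close>. The indicator lets
  \<open>f\<close> be infinite, in which case the integral exceeds every real number.\<close>

lemma epowr_layer_cake:
  assumes "0 < p"
  shows "epowr f p = (\<integral>\<^sup>+ t. ennreal (p * t powr (p - 1)) * indicator {t. 0 < t \<and> ennreal t < f} t \<partial>lborel)"
proof -
  have fin: "(\<integral>\<^sup>+ t. ennreal (p * t powr (p - 1)) * indicator {t. 0 < t \<and> ennreal t < ennreal c} t \<partial>lborel)
      = ennreal (c powr p)" if "0 \<le> c" for c
  proof -
    have "((\<lambda>t. p * t powr (p - 1)) has_integral p * (c powr (p - 1 + 1) / (p - 1 + 1))) {0..c}"
      using assms that by (intro has_integral_mult_right has_integral_powr_from_0) auto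
    then have "((\<lambda>t. p * t powr (p - 1)) has_integral c powr p) {0..c}"
      using assms by simp
    from nn_integral_has_integral_lebesgue[OF _ this]
    have *: "(\<integral>\<^sup>+ t. indicator {0..c} t * ennreal (p * t powr (p - 1)) \<partial>lborel) = ennreal (c powr p)"
      using assms by (simp add: ennreal_mult' ennreal_indicator)
    have "(\<integral>\<^sup>+ t. ennreal (p * t powr (p - 1)) * indicator {t. 0 < t \<and> ennreal t < ennreal c} t \<partial>lborel)
      = (\<integral>\<^sup>+ t. indicator {0..c} t * ennreal (p * t powr (p - 1)) \<partial>lborel)"
      \<comment> \<open>The two integrands differ only at the endpoints, which are null
        sets.\<close>
      using AE_lborel_singleton[of 0] AE_lborel_singleton[of c]
      by (intro nn_integral_cong_AE, eventually_elim) (auto simp: indicator_def ennreal_less_iff)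
    with * show ?thesis by simp
  qed
  show ?thesis
  proof (cases f)
    case (real c)
    with fin[of c] show ?thesis
      by (simp add: epowr_ennreal)
  next
    case top
    have "ennreal x \<le> (\<integral>\<^sup>+ t. ennreal (p * t powr (p - 1)) * indicator {t. 0 < t \<and> ennreal t < f} t \<partial>lborel)"
      if "0 \<le> x" for x
    proof -
      \<comment> \<open>The finite case at level x^(1/p) has the value \<open>x\<close>, and its
        integrand lies below the one for \<open>f = top\<close>.\<close>
      have "ennreal x = ennreal ((x powr (1 / p)) powr p)"
        using assms that by (simp add: powr_powr)
      also have "\<dots> \<le> (\<integral>\<^sup>+ t. ennreal (p * t powr (p - 1)) * indicator {t. 0 < t \<and> ennreal t < f} t \<partial>lborel)"
        unfolding fin[OF powr_ge_zero, symmetric]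
        by (intro nn_integral_mono) (auto simp: top indicator_def)
      finally show ?thesis .
    qed
    note le = this
    show ?thesis
    proof (cases "\<integral>\<^sup>+ t. ennreal (p * t powr (p - 1)) * indicator {t. 0 < t \<and> ennreal t < f} t \<partial>lborel")
      case (real c)
      with le[of "c + 1"] show ?thesis by simp
    qed (simp add: top)
  qed
qed

lemma nn_integral_epowr_layer_cake:
  assumes "sigma_finite_measure M" and f [measurable]: "f \<in> borel_measurable M" and "0 < p"
  shows "(\<integral>\<^sup>+ x. epowr (f x) p \<partial>M) =
    (\<integral>\<^sup>+ t. ennreal (p * t powr (p - 1)) * indicator {0<..} t * emeasure M {x \<in> space M. ennreal t < f x} \<partial>lborel)"
proof -
  interpret sigma_finite_measure M by fact
  interpret pair_sigma_finite M lborel ..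
  have "(\<integral>\<^sup>+ x. epowr (f x) p \<partial>M) = (\<integral>\<^sup>+ x. (\<integral>\<^sup>+ t. ennreal (p * t powr (p - 1)) * indicator {0<..} t *
      indicator {x \<in> space M. ennreal t < f x} x \<partial>lborel) \<partial>M)"
    unfolding epowr_layer_cake[OF \<open>0 < p\<close>]
    by (intro nn_integral_cong) (auto simp: indicator_def intro!: nn_integral_cong)
  also have "\<dots> = (\<integral>\<^sup>+ t. (\<integral>\<^sup>+ x. ennreal (p * t powr (p - 1)) * indicator {0<..} t *
      indicator {x \<in> space M. ennreal t < f x} x \<partial>M) \<partial>lborel)"
    by (intro Fubini'[symmetric]) (simp add: indicator_def split_beta', measurable)
  also have "\<dots> = (\<integral>\<^sup>+ t. ennreal (p * t powr (p - 1)) * indicator {0<..} t * emeasure M {x \<in> space M. ennreal t < f x} \<partial>lborel)"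
    by (intro nn_integral_cong) (simp add: nn_integral_cmult)
  finally show ?thesis .
qed

text \<open>The index \<open>k\<close> precedes the first \<open>n\<close> at which t/2^n falls
  below \<open>z\<close>; that \<open>n\<close> is not 0 because \<open>z \<le> t\<close>.\<close>

lemma dyadic_shell:
  assumes "0 < z" "z \<le> (t::real)"
  obtains k :: nat where "t / 2 ^ k / 2 < z" "z \<le> t / 2 ^ k"
proof -
  obtain n0 where "t / z < 2 ^ n0"
    using real_arch_pow[of 2 "t / z"] by auto
  then have ex: "\<exists>n::nat. t / 2 ^ n < z"
    using assms by (intro exI[of _ n0]) (simp add: field_simps)
  define n where "n = (LEAST n::nat. t / 2 ^ n < z)"
  have n: "t / 2 ^ n < z"
    unfolding n_def using ex by (rule LeastI_ex)
  with assms have "n \<noteq> 0"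
    by (metis div_by_1 not_le power_0)
  then obtain k where k: "n = Suc k"
    by (cases n) auto
  have "\<not> t / 2 ^ k < z"
    using k unfolding n_def by (intro not_less_Least) auto
  with n k show ?thesis
    by (intro that[of k]) (auto simp: field_simps)
qed

text \<open>At most half of \<open>Y\<close> is moved to the left-hand side. Subtraction requires
  \<open>Y\<close> to be finite, which is why energies are truncated before this is applied.\<close>

lemma ennreal_absorb:
  fixes B X Y :: ennreal and \<eta> :: real
  assumes "Y \<le> B + ennreal \<eta> * (Y + X)" "Y < top" "0 \<le> \<eta>" "\<eta> \<le> 1 / 2"
  shows "Y \<le> 2 * B + ennreal (2 * \<eta>) * X"
proof -
  have *: "ennreal 2 = 2" by simp
  show ?thesis
  \<comment> \<open>For \<eta> = 0 the last term vanishes even if \<open>X\<close> is infinite; for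
    \<eta> > 0 an infinite \<open>X\<close> makes the right-hand side infinite.\<close>
  proof (cases "\<eta> = 0")
    case True
    then have "Y \<le> B" using assms by simp
    also have "B \<le> 2 * B" using mult_right_mono[of 1 2 B] by simp
    finally show ?thesis using True by simp
  next
    case False
    show ?thesis
    proof (cases B; cases X; cases Y)
      fix b x y assume r: "B = ennreal b" "0 \<le> b" "X = ennreal x" "0 \<le> x" "Y = ennreal y" "0 \<le> y"
      have "y \<le> b + \<eta> * (y + x)"
        using assms r by (simp add: ennreal_mult[symmetric] ennreal_plus[symmetric] del: ennreal_plus)
      moreover have "\<eta> * y \<le> y / 2"
        using assms r mult_right_mono[of \<eta> "1 / 2" y] by simp
      ultimately have "y \<le> 2 * b + 2 * \<eta> * x"
        by (simp add: algebra_simps)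
      then show ?thesis
        using assms r by (simp add: *[symmetric] ennreal_mult[symmetric] ennreal_plus[symmetric] del: ennreal_plus ennreal_numeral)
    qed (use assms False in \<open>auto simp: ennreal_mult_top\<close>)
  qed
qed

section \<open>Potentials and the weak maximum principle\<close>

lemma borel_measuresD:
  assumes "\<mu> \<in> \<M>\<^sup>+ \<Omega>"
  shows "space \<mu> = \<Omega>" "sets \<mu> = sets (restrict_space borel \<Omega>)"
    "\<And>K. compact K \<Longrightarrow> K \<subseteq> \<Omega> \<Longrightarrow> emeasure \<mu> K < \<infinity>"
  using assms by (auto simp: borel_measures_def)

lemma compact_in_sets_borel_measures:
  fixes \<mu> :: "'a::euclidean_space measure"
  assumes "\<mu> \<in> \<M>\<^sup>+ \<Omega>" "open \<Omega>" "compact K" "K \<subseteq> \<Omega>"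
  shows "K \<in> sets \<mu>"
  using assms by (simp add: borel_measuresD(2)[OF assms(1)] sets_restrict_space_iff compact_imp_closed)

lemma density_in_borel_measures:
  fixes \<mu> :: "'a::euclidean_space measure"
  assumes "\<mu> \<in> \<M>\<^sup>+ \<Omega>" "open \<Omega>" and g [measurable]: "g \<in> borel_measurable \<mu>"
    and "\<And>K. compact K \<Longrightarrow> K \<subseteq> \<Omega> \<Longrightarrow> (\<integral>\<^sup>+ x\<in>K. g x \<partial>\<mu>) < \<infinity>"
  shows "density \<mu> g \<in> \<M>\<^sup>+ \<Omega>"
  using assms compact_in_sets_borel_measures[OF assms(1,2)] borel_measuresD(1,2)[OF assms(1)]
  by (auto simp: borel_measures_def emeasure_density)

lemma density_le_in_borel_measures:
  fixes \<mu> :: "'a::euclidean_space measure"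
  assumes \<mu>: "\<mu> \<in> \<M>\<^sup>+ \<Omega>" and "open \<Omega>" and [measurable]: "f \<in> borel_measurable \<mu>" "g \<in> borel_measurable \<mu>"
    and g: "density \<mu> g \<in> \<M>\<^sup>+ \<Omega>" and le: "\<And>x. x \<in> \<Omega> \<Longrightarrow> f x \<le> g x"
  shows "density \<mu> f \<in> \<M>\<^sup>+ \<Omega>"
proof (intro density_in_borel_measures \<mu> \<open>open \<Omega>\<close>)
  fix K assume K: "compact K" "K \<subseteq> \<Omega>"
  have "(\<integral>\<^sup>+ x\<in>K. f x \<partial>\<mu>) \<le> (\<integral>\<^sup>+ x\<in>K. g x \<partial>\<mu>)"
    using borel_measuresD(1)[OF \<mu>] le by (intro nn_integral_mono mult_right_mono) auto
  also have "\<dots> = emeasure (density \<mu> g) K"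
    using compact_in_sets_borel_measures[OF \<mu> \<open>open \<Omega>\<close> K] by (simp add: emeasure_density)
  also have "\<dots> < \<infinity>"
    by (rule borel_measuresD[OF g]) (use K in auto)
  finally show "(\<integral>\<^sup>+ x\<in>K. f x \<partial>\<mu>) < \<infinity>" .
qed measurable

lemma density_indicator_in_borel_measures:
  fixes \<mu> :: "'a::euclidean_space measure"
  assumes \<mu>: "\<mu> \<in> \<M>\<^sup>+ \<Omega>" and "open \<Omega>" and "E \<in> sets \<mu>"
  shows "density \<mu> (indicator E) \<in> \<M>\<^sup>+ \<Omega>"
proof (rule density_le_in_borel_measures[OF \<mu> \<open>open \<Omega>\<close>])
  show "density \<mu> (\<lambda>_. 1) \<in> \<M>\<^sup>+ \<Omega>"
    using \<mu> by (simp add: density_1)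
qed (use assms in \<open>auto simp: indicator_def\<close>)

lemma density_epowr_in_borel_measures:
  fixes \<mu> :: "'a::euclidean_space measure"
  assumes "\<mu> \<in> \<M>\<^sup>+ \<Omega>" "open \<Omega>" "in_Lp_loc p \<mu> u"
  shows "density \<mu> (\<lambda>x. epowr (u x) p) \<in> \<M>\<^sup>+ \<Omega>"
  using assms borel_measuresD(1)[OF assms(1)]
  by (intro density_in_borel_measures) (auto simp: in_Lp_loc_def)

text \<open>\<open>epowr_le_one_add\<close> is integrated over a compact set, whose measure is
  finite. For p = q this makes u^q d\<sigma> a locally finite measure, to which the weak maximum
  principle applies.\<close>

lemma in_Lp_loc_if_in_Lp:
  fixes \<mu> :: "'a::euclidean_space measure"
  assumes \<mu>: "\<mu> \<in> \<M>\<^sup>+ \<Omega>" and "open \<Omega>" and u: "in_Lp s \<mu> u" and "0 \<le> p" "p \<le> s"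
  shows "in_Lp_loc p \<mu> u"
  unfolding in_Lp_loc_def
proof (intro conjI allI impI)
  show [measurable]: "u \<in> borel_measurable \<mu>"
    using u by (simp add: in_Lp_def)
  fix K assume K: "compact K \<and> K \<subseteq> space \<mu>"
  then have [measurable]: "K \<in> sets \<mu>"
    using compact_in_sets_borel_measures[OF \<mu> \<open>open \<Omega>\<close>] borel_measuresD(1)[OF \<mu>] by auto
  have "(\<integral>\<^sup>+ x\<in>K. epowr (u x) p \<partial>\<mu>) \<le> (\<integral>\<^sup>+ x. indicator K x + epowr (u x) s \<partial>\<mu>)"
    using epowr_le_one_add[OF \<open>0 \<le> p\<close> \<open>p \<le> s\<close>] by (intro nn_integral_mono) (auto simp: indicator_def)
  also have "\<dots> = emeasure \<mu> K + (\<integral>\<^sup>+ x. epowr (u x) s \<partial>\<mu>)"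
    by (simp add: nn_integral_add)
  also have "\<dots> < \<infinity>"
    using u K borel_measuresD(1,3)[OF \<mu>] by (auto simp: in_Lp_def)
  finally show "(\<integral>\<^sup>+ x\<in>K. epowr (u x) p \<partial>\<mu>) < \<infinity>" .
qed

lemma open_exhausted_by_compacts:
  fixes \<Omega> :: "'a::euclidean_space set"
  assumes "open \<Omega>"
  obtains C :: "nat \<Rightarrow> 'a set" where "\<And>n. compact (C n)" "incseq C" "(\<Union>n. C n) = \<Omega>"
proof -
  obtain D where D: "countable D" "D \<subseteq> Pow \<Omega>" "\<And>X. X \<in> D \<Longrightarrow> \<exists>a b. X = cbox a b" "\<Union>D = \<Omega>"
    using open_countable_Union_open_cbox[OF assms] by auto
  \<comment> \<open>The empty set is added because an enumeration by the natural numbers requires a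
    nonempty family.\<close>
  have "countable (insert {} D)"
    using D(1) by simp
  then obtain c :: "nat \<Rightarrow> 'a set" where c: "range c = insert {} D"
    using range_from_nat_into[of "insert {} D"] by blast
  show ?thesis
  proof
    have "compact (c i)" for i
      using D(3)[of "c i"] c rangeI[of c i] by (auto simp: compact_cbox)
    then show "compact (\<Union>i<n. c i)" for n
      by (intro compact_UN) auto
    show "incseq (\<lambda>n. \<Union>i<n. c i)"
      by (fastforce simp: incseq_def)
    have "(\<Union>n. \<Union>i<n. c i) = \<Union>(range c)"
      by blast
    then show "(\<Union>n. \<Union>i<n. c i) = \<Omega>"
      by (simp add: c D(4))
  qed
qed

lemma sigma_finite_borel_measures:
  fixes \<mu> :: "'a::euclidean_space measure"
  assumes \<mu>: "\<mu> \<in> \<M>\<^sup>+ \<Omega>" and "open \<Omega>"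
  shows "sigma_finite_measure \<mu>"
proof -
  obtain C :: "nat \<Rightarrow> 'a set" where C: "\<And>n. compact (C n)" "(\<Union>n. C n) = \<Omega>"
    using open_exhausted_by_compacts[OF \<open>open \<Omega>\<close>] by blast
  then have "C n \<subseteq> \<Omega>" for n
    by auto
  with C show ?thesis
    using compact_in_sets_borel_measures[OF \<mu> \<open>open \<Omega>\<close>] borel_measuresD(1,3)[OF \<mu>]
    unfolding sigma_finite_measure_def by (intro exI[of _ "range C"]) (auto simp: less_top)
qed

lemma null_measure_if_space_null:
  assumes "sets \<mu> = sets N" "emeasure \<mu> (space \<mu>) = 0"
  shows "\<mu> = null_measure N"
  using assms by (intro measure_eqI) (auto simp: emeasure_eq_0[OF sets.top] sets.sets_into_space)

section \<open>Kernels with the weak maximum principle and their potentials\<close>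

locale wmp_kernel =
  fixes \<Omega> :: "'a::euclidean_space set" and G :: "'a \<Rightarrow> 'a \<Rightarrow> ennreal" and h :: real
  assumes open_\<Omega>: "open \<Omega>"
    and G_pos: "\<And>x y. x \<in> \<Omega> \<Longrightarrow> y \<in> \<Omega> \<Longrightarrow> 0 < G x y"
    and lsc: "lsc_kernel_on \<Omega> G"
    and wmp: "weak_max_principle_const \<Omega> G h"
    and h_ge_1: "1 \<le> h"
begin

abbreviation "\<B> \<equiv> restrict_space borel \<Omega>"

lemma space_\<B> [simp]: "space \<B> = \<Omega>"
  by (simp add: space_restrict_space)

lemma open_kernel_greater: "open {(x, y) \<in> \<Omega> \<times> \<Omega>. c < G x y}"
  using lsc open_\<Omega> by (simp add: lsc_kernel_on_def open_Times openin_open_eq)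

text \<open>Extension by 0 outside \<Omega> \<times> \<Omega> keeps the strict superlevel sets open,
  so the extension \<open>H\<close> is Borel on the whole product.\<close>

lemma measurable_kernel_pair: "(\<lambda>(x, y). G x y) \<in> borel_measurable (\<B> \<Otimes>\<^sub>M \<B>)"
proof -
  define H where "H = (\<lambda>z. if z \<in> \<Omega> \<times> \<Omega> then G (fst z) (snd z) else 0)"
  have "open {z. c < H z}" for c
  proof -
    note open_kernel_greater[of c]
    also have "{(x, y) \<in> \<Omega> \<times> \<Omega>. c < G x y} = {z. c < H z}"
      by (auto simp: H_def split: if_splits)
    finally show ?thesis .
  qed
  then have "H \<in> borel_measurable borel"
    by (intro borel_measurableI_greater) auto
  then have [measurable]: "H \<in> borel_measurable (borel \<Otimes>\<^sub>M borel)"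
    by (simp add: borel_prod)
  have [measurable]: "(\<lambda>x. x) \<in> \<B> \<rightarrow>\<^sub>M borel"
    by (rule measurable_restrict_space1) simp
  have "(\<lambda>z. H (fst z, snd z)) \<in> borel_measurable (\<B> \<Otimes>\<^sub>M \<B>)"
    by measurable
  then show ?thesis
    by (rule measurable_cong[THEN iffD1, rotated]) (auto simp: H_def space_pair_measure)
qed

lemma measurable_kernel:
  assumes "sets \<mu> = sets \<B>" "x \<in> \<Omega>"
  shows "G x \<in> borel_measurable \<mu>"
  using measurable_Pair2[OF measurable_kernel_pair, of x] assms
  by (simp add: measurable_cong_sets[OF assms(1) refl])

lemma potential_density:
  assumes "sets \<mu> = sets \<B>" "g \<in> borel_measurable \<mu>" "x \<in> \<Omega>"
  shows "potential G (density \<mu> g) x = (\<integral>\<^sup>+ y. g y * G x y \<partial>\<mu>)"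
  unfolding potential_def using assms measurable_kernel by (intro nn_integral_density) auto

text \<open>Fatou's lemma carries lower semicontinuity of the kernel over to the integral.\<close>

lemma potential_le_liminf:
  assumes \<mu>: "sets \<mu> = sets \<B>" and x: "\<And>n. x n \<in> \<Omega>" "x \<longlonglongrightarrow> l" "l \<in> \<Omega>"
  shows "potential G \<mu> l \<le> liminf (\<lambda>n. potential G \<mu> (x n))"
proof -
  have "G l y \<le> liminf (\<lambda>n. G (x n) y)" if "y \<in> \<Omega>" for y
    unfolding le_Liminf_iff
  proof (intro allI impI)
    fix b assume "b < G l y"
    moreover have "(\<lambda>n. (x n, y)) \<longlonglongrightarrow> (l, y)"
      using x by (intro tendsto_intros) auto
    ultimately have "\<forall>\<^sub>F n in sequentially. (x n, y) \<in> {(x, y) \<in> \<Omega> \<times> \<Omega>. b < G x y}"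
      using x that open_kernel_greater by (intro topological_tendstoD) auto
    then show "\<forall>\<^sub>F n in sequentially. b < G (x n) y"
      by eventually_elim auto
  qed
  then have "potential G \<mu> l \<le> (\<integral>\<^sup>+ y. liminf (\<lambda>n. G (x n) y) \<partial>\<mu>)"
    unfolding potential_def using sets_eq_imp_space_eq[OF \<mu>] by (intro nn_integral_mono) simp
  also have "\<dots> \<le> liminf (\<lambda>n. potential G \<mu> (x n))"
    unfolding potential_def using x by (intro nn_integral_liminf measurable_kernel \<mu>) auto
  finally show ?thesis .
qed

text \<open>Lower semicontinuity of potentials, by sequences in the complement. Openness is what
  later allows these sets to be removed from the support of a measure.\<close>

lemma open_potential_greater:
  assumes \<mu>: "sets \<mu> = sets \<B>"
  shows "open {x \<in> \<Omega>. c < potential G \<mu> x}"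
proof -
  have "closed (- {x \<in> \<Omega>. c < potential G \<mu> x})"
    unfolding closed_sequential_limits
  proof (intro allI impI)
    fix x l assume *: "(\<forall>n. x n \<in> - {x \<in> \<Omega>. c < potential G \<mu> x}) \<and> x \<longlonglongrightarrow> l"
    show "l \<in> - {x \<in> \<Omega>. c < potential G \<mu> x}"
    proof
      assume l: "l \<in> {x \<in> \<Omega>. c < potential G \<mu> x}"
      then have "\<forall>\<^sub>F n in sequentially. x n \<in> \<Omega>"
        using * open_\<Omega> by (intro topological_tendstoD) auto
      then obtain N where N: "\<And>n. N \<le> n \<Longrightarrow> x n \<in> \<Omega>"
        by (auto simp: eventually_sequentially)
      have "potential G \<mu> l \<le> liminf (\<lambda>n. potential G \<mu> (x (n + N)))"
        using * l N by (intro potential_le_liminf[OF \<mu>] LIMSEQ_ignore_initial_segment) auto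
      also have "\<dots> \<le> liminf (\<lambda>n. c)"
        using * N by (intro Liminf_mono always_eventually) (auto simp: not_less)
      finally show False
        using l by (simp add: Liminf_const not_less[symmetric])
    qed
  qed
  then show ?thesis
    by (simp add: closed_def)
qed

lemma measurable_potential:
  assumes "sets \<mu> = sets \<B>"
  shows "potential G \<mu> \<in> borel_measurable \<B>"
proof (rule borel_measurableI_greater)
  fix c
  show "{x \<in> space \<B>. c < potential G \<mu> x} \<in> sets \<B>"
    using open_potential_greater[OF assms, of c] open_\<Omega>
    by (auto simp: sets_restrict_space_iff)
qed

lemma measurable_potential':
  assumes "sets \<mu> = sets \<B>" "sets \<nu> = sets \<B>"
  shows "potential G \<mu> \<in> borel_measurable \<nu>"
  using measurable_potential[OF assms(1)] by (simp add: measurable_cong_sets[OF assms(2) refl])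

lemma potential_mono_density:
  assumes "sets \<mu> = sets \<B>" "f \<in> borel_measurable \<mu>" "g \<in> borel_measurable \<mu>" "x \<in> \<Omega>"
    and "\<And>y. y \<in> \<Omega> \<Longrightarrow> f y \<le> g y"
  shows "potential G (density \<mu> f) x \<le> potential G (density \<mu> g) x"
  using assms sets_eq_imp_space_eq[OF assms(1)]
  by (auto simp: potential_density intro!: nn_integral_mono mult_right_mono)

text \<open>A vanishing integral of the strictly positive function \<open>G x\<close> forces \<mu>
  to have no mass.\<close>

lemma potential_pos:
  assumes \<mu>: "sets \<mu> = sets \<B>" and "emeasure \<mu> \<Omega> \<noteq> 0" and "x \<in> \<Omega>"
  shows "0 < potential G \<mu> x"
proof (rule ccontr)
  assume "\<not> 0 < potential G \<mu> x"
  then have "(\<integral>\<^sup>+ y. G x y \<partial>\<mu>) = 0"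
    by (simp add: potential_def)
  then have "AE y in \<mu>. G x y = 0"
    using measurable_kernel[OF \<mu> \<open>x \<in> \<Omega>\<close>] by (simp add: nn_integral_0_iff_AE)
  moreover have sp: "space \<mu> = \<Omega>"
    using sets_eq_imp_space_eq[OF \<mu>] by simp
  ultimately have "AE y in \<mu>. False"
    using G_pos[OF \<open>x \<in> \<Omega>\<close>] by (auto elim!: AE_mp simp: less_le)
  then show False
    using assms(2) sp by (simp add: eventually_ae_filter null_sets_def) (metis emeasure_eq_0 sets.top)
qed

lemma potential_density_pos:
  assumes \<mu>: "sets \<mu> = sets \<B>" and g: "g \<in> borel_measurable \<mu>" and "x \<in> \<Omega>"
    and "\<not> (AE y in \<mu>. g y = 0)"
  shows "0 < potential G (density \<mu> g) x"
proof (rule potential_pos)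
  have "space \<mu> = \<Omega>"
    using sets_eq_imp_space_eq[OF \<mu>] by simp
  then have "emeasure (density \<mu> g) \<Omega> = (\<integral>\<^sup>+ y. g y \<partial>\<mu>)"
    using g by (simp add: emeasure_density flip: \<open>space \<mu> = \<Omega>\<close>)
  then show "emeasure (density \<mu> g) \<Omega> \<noteq> 0"
    using assms(4) g by (simp add: nn_integral_0_iff_AE)
qed (use assms in auto)

section \<open>Quantitative forms of the weak maximum principle\<close>

text \<open>Dividing \<mu> by \<open>s\<close> reduces to the normalised principle. An open null set
  is disjoint from the support, so a bound off \<open>U\<close> is a bound on the support, which
  never has to be computed.\<close>

lemma weak_max:
  assumes \<mu>: "\<mu> \<in> \<M>\<^sup>+ \<Omega>" and U: "open U" "U \<subseteq> \<Omega>" "emeasure \<mu> U = 0"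
    and s: "0 < s" "\<And>x. x \<in> \<Omega> - U \<Longrightarrow> potential G \<mu> x \<le> ennreal s" and "x \<in> \<Omega>"
  shows "potential G \<mu> x \<le> ennreal (h * s)"
proof -
  define \<nu> where "\<nu> = scale_measure (ennreal (1 / s)) \<mu>"
  have pot: "potential G \<nu> y = ennreal (1 / s) * potential G \<mu> y" if "y \<in> \<Omega>" for y
    unfolding \<nu>_def potential_def
    using measurable_kernel[OF borel_measuresD(2)[OF \<mu>] that] by (simp add: nn_integral_scale_measure)
  have \<nu>: "\<nu> \<in> \<M>\<^sup>+ \<Omega>"
    using borel_measuresD[OF \<mu>] by (auto simp: borel_measures_def \<nu>_def ennreal_mult_less_top space_scale_measure)
  have "msupport \<nu> \<subseteq> \<Omega> - U"
    using U borel_measuresD(1)[OF \<nu>]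
    by (auto simp: msupport_def \<nu>_def Int_absorb2)
  moreover have "potential G \<nu> y \<le> 1" if "y \<in> \<Omega> - U" for y
  proof -
    have "potential G \<nu> y \<le> ennreal (1 / s) * ennreal s"
      using s that by (auto simp: pot intro!: mult_left_mono)
    also have "\<dots> = 1"
      using s by (simp add: ennreal_mult[symmetric])
    finally show ?thesis .
  qed
  ultimately have "potential G \<nu> x \<le> ennreal h"
    using wmp \<nu> \<open>x \<in> \<Omega>\<close> unfolding weak_max_principle_const_def by (meson subsetD)
  then have "ennreal s * (ennreal (1 / s) * potential G \<mu> x) \<le> ennreal s * ennreal h"
    unfolding pot[OF \<open>x \<in> \<Omega>\<close>] by (intro mult_left_mono) auto
  moreover have "ennreal s * (ennreal (1 / s) * potential G \<mu> x) = potential G \<mu> x"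
    using s by (simp add: ennreal_mult[symmetric] mult.assoc[symmetric])
  ultimately show ?thesis
    using s h_ge_1 by (simp add: ennreal_mult[symmetric] mult.commute)
qed

lemma weak_max_density:
  assumes \<nu>: "\<nu> \<in> \<M>\<^sup>+ \<Omega>" "density \<nu> g \<in> \<M>\<^sup>+ \<Omega>" and g [measurable]: "g \<in> borel_measurable \<nu>"
    and U: "open U" "U \<subseteq> \<Omega>" "\<And>y. y \<in> U \<Longrightarrow> g y = 0"
    and s: "0 < s" "\<And>x. x \<in> \<Omega> - U \<Longrightarrow> potential G (density \<nu> g) x \<le> ennreal s" and "x \<in> \<Omega>"
  shows "potential G (density \<nu> g) x \<le> ennreal (h * s)"
proof (rule weak_max[OF \<nu>(2) U(1,2) _ s \<open>x \<in> \<Omega>\<close>])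
  have "U \<in> sets \<nu>"
    using U open_\<Omega> by (simp add: borel_measuresD(2)[OF \<nu>(1)] sets_restrict_space_iff)
  then have "emeasure (density \<nu> g) U = (\<integral>\<^sup>+ y. g y * indicator U y \<partial>\<nu>)"
    by (simp add: emeasure_density)
  also have "\<dots> = (\<integral>\<^sup>+ y. 0 \<partial>\<nu>)"
    by (intro nn_integral_cong) (simp add: U(3) split: split_indicator)
  finally show "emeasure (density \<nu> g) U = 0"
    by simp
qed

text \<open>Off the open set where the potential of \<nu> exceeds \<open>s\<close>, the restricted
  potential is below the full one and hence below \<open>s\<close>; the set itself is disjoint from
  \<open>E\<close>.\<close>

lemma potential_sublevel_le:
  assumes \<nu>: "\<nu> \<in> \<M>\<^sup>+ \<Omega>" and E [measurable]: "E \<in> sets \<nu>" and s: "0 < s"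
    and le: "\<And>y. y \<in> E \<Longrightarrow> potential G \<nu> y \<le> ennreal s" and x: "x \<in> \<Omega>"
  shows "potential G (density \<nu> (indicator E)) x \<le> ennreal (h * s)"
proof (rule weak_max_density[where U = "{y \<in> \<Omega>. ennreal s < potential G \<nu> y}"])
  note sets = borel_measuresD(2)[OF \<nu>]
  show "open {y \<in> \<Omega>. ennreal s < potential G \<nu> y}"
    by (rule open_potential_greater[OF sets])
  show "indicator E y = 0" if "y \<in> {y \<in> \<Omega>. ennreal s < potential G \<nu> y}" for y
    using that le[of y] by (auto simp: indicator_def)
  show "potential G (density \<nu> (indicator E)) y \<le> ennreal s"
    if "y \<in> \<Omega> - {y \<in> \<Omega>. ennreal s < potential G \<nu> y}" for y
  proof -
    have "potential G (density \<nu> (indicator E)) y \<le> potential G (density \<nu> (\<lambda>_. 1)) y"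
      using that sets by (intro potential_mono_density) (auto simp: indicator_def)
    also have "\<dots> \<le> ennreal s"
      using that by (auto simp: density_1 not_less)
    finally show ?thesis .
  qed
  show "density \<nu> (indicator E) \<in> \<M>\<^sup>+ \<Omega>"
    by (rule density_indicator_in_borel_measures[OF \<nu> open_\<Omega> E])
qed (use assms in auto)

text \<open>The part of \<mu> where the potential is at most \<open>t\<close> contributes at most
  \<open>h * t\<close>. This is no more than half of \<open>potential G \<mu> x\<close>, so the part
  above \<open>t\<close> supplies the other half.\<close>

lemma potential_le_superlevel:
  assumes \<mu>: "\<mu> \<in> \<M>\<^sup>+ \<Omega>" and "0 < t" and x: "x \<in> \<Omega>" and le: "ennreal (2 * h * t) \<le> potential G \<mu> x"
  shows "potential G \<mu> x \<le> 2 * (\<integral>\<^sup>+ y. indicator {y \<in> \<Omega>. ennreal t < potential G \<mu> y} y * G x y \<partial>\<mu>)"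
proof -
  note sets = borel_measuresD(2)[OF \<mu>]
  note [measurable] = measurable_potential'[OF sets sets] measurable_kernel[OF sets x]
  have sp: "space \<mu> = \<Omega>"
    by (rule borel_measuresD(1)[OF \<mu>])
  let ?E = "{y \<in> space \<mu>. \<not> ennreal t < potential G \<mu> y}" and ?F = "{y \<in> space \<mu>. ennreal t < potential G \<mu> y}"
  define Y where "Y = (\<integral>\<^sup>+ y. indicator ?F y * G x y \<partial>\<mu>)"
  have E: "(\<integral>\<^sup>+ y. indicator ?E y * G x y \<partial>\<mu>) \<le> ennreal (h * t)"
  proof -
    have "potential G (density \<mu> (indicator ?E)) x \<le> ennreal (h * t)"
      by (rule potential_sublevel_le[OF \<mu>]) (use x \<open>0 < t\<close> in \<open>auto simp: not_less\<close>)
    then show ?thesis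
      by (subst (asm) potential_density[OF sets _ x]) measurable
  qed
  have "potential G \<mu> x = (\<integral>\<^sup>+ y. indicator ?E y * G x y + indicator ?F y * G x y \<partial>\<mu>)"
    unfolding potential_def by (intro nn_integral_cong) (simp split: split_indicator)
  also have "\<dots> = (\<integral>\<^sup>+ y. indicator ?E y * G x y \<partial>\<mu>) + Y"
    unfolding Y_def by (intro nn_integral_add) measurable
  also have "\<dots> \<le> ennreal (h * t) + Y"
    using E by (intro add_right_mono)
  finally have *: "potential G \<mu> x \<le> ennreal (h * t) + Y" .
  have "potential G \<mu> x \<le> 2 * Y"
  \<comment> \<open>Halving requires finite values; if \<open>Y\<close> is infinite there is nothing
    to show.\<close>
  proof (cases Y)
    case (real y)
    then have "potential G \<mu> x \<noteq> top"
      using * by (auto simp: top_unique)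
    then obtain p where p: "potential G \<mu> x = ennreal p" "0 \<le> p"
      by (cases "potential G \<mu> x") auto
    have "p \<le> h * t + y" "2 * h * t \<le> p"
      using * le p real h_ge_1 \<open>0 < t\<close> by (simp_all add: ennreal_plus[symmetric] del: ennreal_plus)
    then have "p \<le> 2 * y"
      by linarith
    then have "ennreal p \<le> ennreal 2 * ennreal y"
      using real by (simp add: ennreal_mult[symmetric] del: ennreal_numeral)
    then show ?thesis
      using p real by simp
  qed (simp add: ennreal_mult_top)
  then show ?thesis
    by (simp add: Y_def sp)
qed

text \<open>Only the mass where the potential exceeds t =
  \<open>potential G \<mu> x / (2 * h)\<close> is kept. There the weight is at least t^p, and by
  \<open>potential_le_superlevel\<close> this mass carries half of the potential at
  \<open>x\<close>. The inequality will make the barrier a subsolution.\<close>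

lemma epowr_potential_le:
  assumes \<mu>: "\<mu> \<in> \<M>\<^sup>+ \<Omega>" and "0 \<le> p" and x: "x \<in> \<Omega>"
  shows "ennreal ((1 / (2 * h)) powr p / 2) * epowr (potential G \<mu> x) (p + 1) \<le>
    potential G (density \<mu> (\<lambda>y. epowr (potential G \<mu> y) p)) x"
proof -
  note sets = borel_measuresD(2)[OF \<mu>]
  note [measurable] = measurable_potential'[OF sets sets] measurable_kernel[OF sets x]
  have sp: "space \<mu> = \<Omega>"
    by (rule borel_measuresD(1)[OF \<mu>])
  define Y where "Y t = (\<integral>\<^sup>+ y. indicator {y \<in> \<Omega>. ennreal t < potential G \<mu> y} y * G x y \<partial>\<mu>)" for t
  have *: "ennreal (t powr p) * Y t \<le> potential G (density \<mu> (\<lambda>y. epowr (potential G \<mu> y) p)) x"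
    if "0 < t" for t
  proof -
    have "ennreal (t powr p) * Y t =
        (\<integral>\<^sup>+ y. ennreal (t powr p) * (indicator {y \<in> \<Omega>. ennreal t < potential G \<mu> y} y * G x y) \<partial>\<mu>)"
      unfolding Y_def sp[symmetric] by (intro nn_integral_cmult[symmetric]) measurable
    also have "\<dots> \<le> (\<integral>\<^sup>+ y. epowr (potential G \<mu> y) p * G x y \<partial>\<mu>)"
    proof (intro nn_integral_mono)
      fix y
      have "ennreal (t powr p) \<le> epowr (potential G \<mu> y) p" if "ennreal t < potential G \<mu> y"
        using epowr_mono[of "ennreal t" "potential G \<mu> y" p] that \<open>0 < t\<close> \<open>0 \<le> p\<close>
        by (simp add: epowr_ennreal)
      then show "ennreal (t powr p) * (indicator {y \<in> \<Omega>. ennreal t < potential G \<mu> y} y * G x y)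
          \<le> epowr (potential G \<mu> y) p * G x y"
        by (auto simp: indicator_def intro!: mult_right_mono)
    qed
    also have "\<dots> = potential G (density \<mu> (\<lambda>y. epowr (potential G \<mu> y) p)) x"
      by (intro potential_density[symmetric] sets x) measurable
    finally show ?thesis .
  qed
  show ?thesis
  proof (cases "potential G \<mu> x")
    \<comment> \<open>For an infinite potential the level 1 suffices: the mass above it already has
      infinite potential at \<open>x\<close>.\<close>
    case top
    then have "Y 1 = top"
      using potential_le_superlevel[OF \<mu>, of 1 x] x by (simp add: Y_def top_unique ennreal_mult_eq_top_iff)
    then show ?thesis
      using *[of 1] by (simp add: top_unique)
  next
    case (real r)
    show ?thesis
    proof (cases "r = 0")
      case False
      define t where "t = r / (2 * h)"
      have t: "0 < t" "2 * h * t = r"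
        using False real h_ge_1 by (auto simp: t_def)
      have "ennreal r \<le> 2 * Y t"
        using potential_le_superlevel[OF \<mu>, of t x] x t real by (simp add: Y_def)
      then have "ennreal (t powr p / 2) * ennreal r \<le> ennreal (t powr p / 2) * (2 * Y t)"
        by (intro mult_left_mono) auto
      also have "\<dots> = ennreal (t powr p) * Y t"
        using ennreal_mult[of "t powr p / 2" 2] by (simp add: mult.assoc[symmetric])
      also have "\<dots> \<le> potential G (density \<mu> (\<lambda>y. epowr (potential G \<mu> y) p)) x"
        using * t by simp
      finally show ?thesis
        using real h_ge_1 by (simp add: epowr_ennreal t_def powr_add powr_divide ennreal_mult[symmetric] field_simps)
    qed (simp add: real)
  qed
qed

section \<open>Energy terms and truncation\<close>

text \<open>Bounds the energy on the right of \<open>potential_energy_estimate\<close> for the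
  measure u^q d\<sigma>. The weight \<open>g\<close> allows \<sigma> to be cut off to a compact
  set.\<close>

lemma energy_le:
  assumes \<sigma>: "sets \<sigma> = sets \<B>" and [measurable]: "u \<in> borel_measurable \<sigma>" "f \<in> borel_measurable \<sigma>" "g \<in> borel_measurable \<sigma>"
    and "0 < \<gamma>" "0 < q"
  shows "(\<integral>\<^sup>+ x. epowr (f x) \<gamma> \<partial>density \<sigma> (\<lambda>x. g x * epowr (u x) q)) \<le>
    (\<integral>\<^sup>+ x. epowr (f x) (\<gamma> + q) \<partial>density \<sigma> g) + (\<integral>\<^sup>+ x. g x * epowr (u x) (\<gamma> + q) \<partial>\<sigma>)"
proof -
  have "(\<integral>\<^sup>+ x. epowr (f x) \<gamma> \<partial>density \<sigma> (\<lambda>x. g x * epowr (u x) q)) =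
      (\<integral>\<^sup>+ x. g x * (epowr (f x) \<gamma> * epowr (u x) q) \<partial>\<sigma>)"
    by (subst nn_integral_density) (auto simp: mult_ac)
  also have "\<dots> \<le> (\<integral>\<^sup>+ x. g x * epowr (f x) (\<gamma> + q) + g x * epowr (u x) (\<gamma> + q) \<partial>\<sigma>)"
    using assms(5,6) unfolding distrib_left[symmetric]
    by (intro nn_integral_mono mult_left_mono epowr_mult_epowr_le) auto
  also have "\<dots> = (\<integral>\<^sup>+ x. epowr (f x) (\<gamma> + q) \<partial>density \<sigma> g) + (\<integral>\<^sup>+ x. g x * epowr (u x) (\<gamma> + q) \<partial>\<sigma>)"
    by (subst nn_integral_add) (auto simp: nn_integral_density)
  finally show ?thesis .
qed

text \<open>Three cut-offs are made at once: the density and the point \<open>x\<close> are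
  restricted to \<open>C n\<close>, and the value is capped at \<open>n\<close>. For compact
  \<open>C n\<close> and locally finite \<sigma> each truncation has finite energy.\<close>

lemma potential_truncation_SUP:
  assumes \<sigma>: "sets \<sigma> = sets \<B>" and g [measurable]: "g \<in> borel_measurable \<sigma>"
    and C: "\<And>n. C n \<in> sets \<sigma>" "incseq C" "(\<Union>n. C n) = \<Omega>" and x: "x \<in> \<Omega>"
  shows "(SUP n. indicator (C n) x * min (potential G (density \<sigma> (\<lambda>y. indicator (C n) y * g y)) x) (ennreal (real n)))
    = potential G (density \<sigma> g) x" (is "(SUP n. ?H n) = ?f")
proof (rule antisym)
  note [measurable] = measurable_kernel[OF \<sigma> x] C(1)
  have sp: "space \<sigma> = \<Omega>"
    using sets_eq_imp_space_eq[OF \<sigma>] by simp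
  let ?p = "\<lambda>n. potential G (density \<sigma> (\<lambda>y. indicator (C n) y * g y)) x"
  have p_le: "?p n \<le> ?f" for n
    using x by (intro potential_mono_density \<sigma>) (auto simp: indicator_def)
  show "(SUP n. ?H n) \<le> ?f"
    by (intro SUP_least) (auto split: split_indicator intro!: min.coboundedI1[OF p_le])
  have p_mono: "?p m \<le> ?p n" if "m \<le> n" for m n
    using that C(2) x by (intro potential_mono_density \<sigma>) (auto simp: indicator_def incseq_def)
  have SUP_p: "?f = (SUP n. ?p n)"
  proof -
    have "(SUP n. ?p n) = (SUP n. \<integral>\<^sup>+ y. indicator (C n) y * g y * G x y \<partial>\<sigma>)"
      by (subst potential_density[OF \<sigma> _ x]) auto
    also have "\<dots> = (\<integral>\<^sup>+ y. (SUP n. indicator (C n) y * g y * G x y) \<partial>\<sigma>)"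
      using C(2) by (intro nn_integral_monotone_convergence_SUP[symmetric])
        (auto simp: incseq_def le_fun_def indicator_def)
    also have "\<dots> = (\<integral>\<^sup>+ y. g y * G x y \<partial>\<sigma>)"
    proof (intro nn_integral_cong antisym)
      fix y assume "y \<in> space \<sigma>"
      then obtain n where "y \<in> C n"
        using C(3) sp by auto
      then show "g y * G x y \<le> (SUP n. indicator (C n) y * g y * G x y)"
        by (intro SUP_upper2[of n]) auto
      show "(SUP n. indicator (C n) y * g y * G x y) \<le> g y * G x y"
        by (intro SUP_least) (auto simp: indicator_def)
    qed
    finally show ?thesis
      by (subst potential_density[OF \<sigma> _ x]) auto
  qed
  show "?f \<le> (SUP n. ?H n)"
  \<comment> \<open>It is enough to reach every \<open>c\<close> below the potential. Such a
    \<open>c\<close> is finite, so one large \<open>n\<close> meets the cap and both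
    restrictions.\<close>
  proof (rule dense_le)
    fix c assume c: "c < ?f"
    then obtain n1 where n1: "c < ?p n1"
      unfolding SUP_p by (auto simp: less_SUP_iff)
    have "c < top"
      using c by (rule less_le_trans) simp
    then obtain r where r: "c = ennreal r" "0 \<le> r"
      by (cases c) auto
    obtain n2 :: nat where n2: "r < real n2"
      using reals_Archimedean2 by blast
    obtain n3 where n3: "x \<in> C n3"
      using C(3) x by auto
    define n where "n = max n1 (max n2 n3)"
    have "n3 \<le> n"
      by (simp add: n_def)
    then have "x \<in> C n"
      using n3 incseqD[OF C(2)] by blast
    moreover have "c \<le> ?p n"
      using n1 p_mono[of n1 n] by (simp add: n_def)
    moreover have "c \<le> ennreal (real n)"
      using n2 r by (auto simp: n_def intro!: ennreal_leI)
    ultimately have "c \<le> ?H n"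
      by simp
    then show "c \<le> (SUP n. ?H n)"
      by (rule SUP_upper2[OF UNIV_I])
  qed
qed

section \<open>Lower bounds for supersolutions\<close>

text \<open>On the shell u \<ge> v > s/2, so \<sigma> there is at most (s/2)^(-q) times u^q
  d\<sigma>. The potential of the latter on the shell is at most \<open>v\<close>, hence at most
  \<open>s\<close> off the open set where \<open>v\<close> exceeds \<open>s\<close>, on which its
  density vanishes; the weak maximum principle gives \<open>h * s\<close> everywhere.\<close>

lemma potential_shell_le:
  fixes q s :: real
  assumes \<sigma>: "\<sigma> \<in> \<M>\<^sup>+ \<Omega>" and u: "in_Lp_loc q \<sigma> u" and q: "0 < q" and s: "0 < s" and x: "x \<in> \<Omega>"
    and le: "\<And>y. y \<in> \<Omega> \<Longrightarrow> potential G (density \<sigma> (\<lambda>y. epowr (u y) q)) y \<le> u y"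
  defines "v \<equiv> potential G (density \<sigma> (\<lambda>y. epowr (u y) q))"
  shows "(\<integral>\<^sup>+ y. indicator {y \<in> \<Omega>. ennreal (s / 2) < v y \<and> v y \<le> ennreal s} y * G x y \<partial>\<sigma>)
    \<le> ennreal (h * 2 powr q * s powr (1 - q))"
proof -
  note sets = borel_measuresD(2)[OF \<sigma>]
  have sp: "space \<sigma> = \<Omega>"
    by (rule borel_measuresD(1)[OF \<sigma>])
  have [measurable]: "u \<in> borel_measurable \<sigma>"
    using u by (simp add: in_Lp_loc_def)
  have [measurable]: "v \<in> borel_measurable \<sigma>"
    unfolding v_def by (intro measurable_potential' sets) (simp add: sets)
  note [measurable] = measurable_kernel[OF sets x]
  define D where "D = {y \<in> \<Omega>. ennreal (s / 2) < v y \<and> v y \<le> ennreal s}"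
  have [measurable]: "D \<in> sets \<sigma>"
    unfolding D_def sp[symmetric] by measurable
  let ?g = "\<lambda>y. indicator D y * epowr (u y) q"
  have uq: "density \<sigma> (\<lambda>y. epowr (u y) q) \<in> \<M>\<^sup>+ \<Omega>"
    by (rule density_epowr_in_borel_measures[OF \<sigma> open_\<Omega> u])
  have pot: "potential G (density \<sigma> ?g) x \<le> ennreal (h * s)"
  proof (rule weak_max_density[where U = "{y \<in> \<Omega>. ennreal s < v y}"])
    show "density \<sigma> ?g \<in> \<M>\<^sup>+ \<Omega>"
      by (rule density_le_in_borel_measures[OF \<sigma> open_\<Omega> _ _ uq]) (auto simp: indicator_def)
    show "open {y \<in> \<Omega>. ennreal s < v y}"
      unfolding v_def by (rule open_potential_greater) (simp add: sets)
    show "indicator D y * epowr (u y) q = 0" if "y \<in> {y \<in> \<Omega>. ennreal s < v y}" for y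
      using that by (auto simp: D_def indicator_def)
    show "potential G (density \<sigma> ?g) y \<le> ennreal s" if "y \<in> \<Omega> - {y \<in> \<Omega>. ennreal s < v y}" for y
    proof -
      have "potential G (density \<sigma> ?g) y \<le> v y"
        unfolding v_def using that by (intro potential_mono_density sets) (auto simp: indicator_def)
      also have "v y \<le> ennreal s"
        using that by (auto simp: not_less)
      finally show ?thesis .
    qed
  qed (use \<sigma> s x in auto)
  define I where "I = (\<integral>\<^sup>+ y. indicator D y * G x y \<partial>\<sigma>)"
  have "ennreal ((s / 2) powr q) * I = (\<integral>\<^sup>+ y. ennreal ((s / 2) powr q) * (indicator D y * G x y) \<partial>\<sigma>)"
    unfolding I_def by (intro nn_integral_cmult[symmetric]) measurable
  also have "\<dots> \<le> (\<integral>\<^sup>+ y. ?g y * G x y \<partial>\<sigma>)"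
  proof (intro nn_integral_mono)
    fix y
    have "ennreal ((s / 2) powr q) \<le> epowr (u y) q" if "y \<in> D"
    proof -
      have "ennreal (s / 2) \<le> u y"
        using that le[of y] by (auto simp: D_def v_def intro: order_trans less_imp_le)
      from epowr_mono[OF this, of q] show ?thesis
        using s q by (simp add: epowr_ennreal)
    qed
    then show "ennreal ((s / 2) powr q) * (indicator D y * G x y) \<le> ?g y * G x y"
      by (auto simp: indicator_def intro!: mult_right_mono)
  qed
  also have "\<dots> = potential G (density \<sigma> ?g) x"
    by (intro potential_density[symmetric] sets x) measurable
  also note pot
  \<comment> \<open>Division by (s/2)^q is carried out as multiplication by (2/s)^q, which leaves h
    2^q s^(1-q).\<close>
  finally have "ennreal ((2 / s) powr q) * (ennreal ((s / 2) powr q) * I) \<le> ennreal ((2 / s) powr q) * ennreal (h * s)"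
    by (intro mult_left_mono) auto
  moreover have "ennreal ((2 / s) powr q) * (ennreal ((s / 2) powr q) * I) = I"
    using s by (simp add: mult.assoc[symmetric] ennreal_mult[symmetric] powr_mult[symmetric])
  moreover have "ennreal ((2 / s) powr q) * ennreal (h * s) = ennreal (h * 2 powr q * s powr (1 - q))"
    using s h_ge_1 by (simp add: ennreal_mult[symmetric] powr_divide powr_diff)
  ultimately show ?thesis
    by (simp add: I_def D_def)
qed

text \<open>With v the potential of u^q d\<sigma> and t = v(x), \<sigma> is cut into the dyadic
  shells of v below t and the part above t. The shell bounds form a convergent geometric series
  because q < 1. The constant depends on neither \<sigma> nor \<open>u\<close>, so one barrier will
  lie below all nontrivial supersolutions.\<close>

lemma potential_le_supersolution:
  fixes q :: real
  assumes "0 < q" "q < 1"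
  obtains C where "0 < C"
    "\<And>\<sigma> u x. \<sigma> \<in> \<M>\<^sup>+ \<Omega> \<Longrightarrow> in_Lp_loc q \<sigma> u \<Longrightarrow> (\<And>x. x \<in> \<Omega> \<Longrightarrow> 0 < u x) \<Longrightarrow>
       (\<And>x. x \<in> \<Omega> \<Longrightarrow> potential G (density \<sigma> (\<lambda>y. epowr (u y) q)) x \<le> u x) \<Longrightarrow> x \<in> \<Omega> \<Longrightarrow>
       potential G \<sigma> x \<le> ennreal C * epowr (u x) (1 - q)"
proof -
  \<comment> \<open>\<open>b\<close> is the ratio of consecutive shell bounds. In \<open>C\<close>
    the first summand comes from the geometric series, and the 1 from the part above the level
    \<open>t\<close>.\<close>
  define b where "b = (1 / 2) powr (1 - q)"
  define c where "c = h * 2 powr q"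
  define C where "C = c * (1 / (1 - b)) + 1"
  have b: "0 < b" "b < 1"
    using assms powr_less_mono2[of "1 - q" "1 / 2" 1] by (auto simp: b_def)
  have c: "0 < c"
    using h_ge_1 by (simp add: c_def)
  have C: "0 < C"
    using b c by (simp add: C_def add_nonneg_pos)
  have "potential G \<sigma> x \<le> ennreal C * epowr (u x) (1 - q)"
    if \<sigma>: "\<sigma> \<in> \<M>\<^sup>+ \<Omega>" and u: "in_Lp_loc q \<sigma> u" and pos: "\<And>x. x \<in> \<Omega> \<Longrightarrow> 0 < u x"
      and le: "\<And>x. x \<in> \<Omega> \<Longrightarrow> potential G (density \<sigma> (\<lambda>y. epowr (u y) q)) x \<le> u x" and x: "x \<in> \<Omega>" for \<sigma> u x
  \<comment> \<open>The zero measure is set apart, since the dyadic decomposition needs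
    \<open>v\<close> to be positive everywhere.\<close>
  proof (cases "AE y in \<sigma>. False")
    case True
    then have "potential G \<sigma> x = (\<integral>\<^sup>+ y. 0 \<partial>\<sigma>)"
      unfolding potential_def by (intro nn_integral_cong_AE) (auto elim: eventually_mono)
    then show ?thesis by simp
  next
    case False
    note sets = borel_measuresD(2)[OF \<sigma>]
    have sp: "space \<sigma> = \<Omega>"
      by (rule borel_measuresD(1)[OF \<sigma>])
    have [measurable]: "u \<in> borel_measurable \<sigma>"
      using u by (simp add: in_Lp_loc_def)
    define v where "v = potential G (density \<sigma> (\<lambda>y. epowr (u y) q))"
    have [measurable]: "v \<in> borel_measurable \<sigma>"
      unfolding v_def by (intro measurable_potential' sets) (simp add: sets)
    note [measurable] = measurable_kernel[OF sets x]
    have "\<not> (AE y in \<sigma>. epowr (u y) q = 0)"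
    proof
      assume "AE y in \<sigma>. epowr (u y) q = 0"
      moreover have "AE y in \<sigma>. 0 < epowr (u y) q"
        using pos by (intro AE_I2) (auto simp: sp)
      ultimately have "AE y in \<sigma>. False"
        by eventually_elim auto
      with False show False by simp
    qed
    then have v_pos: "0 < v y" if "y \<in> \<Omega>" for y
      unfolding v_def using that by (intro potential_density_pos sets) auto
    show ?thesis
    proof (cases "v x")
      case top
      then have "u x = top"
        using le[OF x] by (simp add: v_def top_unique)
      then show ?thesis
        using C by (simp add: ennreal_mult_top)
    next
      case (real t)
      with v_pos[OF x] have t: "0 < t"
        by (cases "t = 0") auto
      define D where "D k = {y \<in> \<Omega>. ennreal (t / 2 ^ k / 2) < v y \<and> v y \<le> ennreal (t / 2 ^ k)}" for k :: nat
      define E where "E = {y \<in> \<Omega>. ennreal t < v y}"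
      have [measurable]: "D k \<in> sets \<sigma>" "E \<in> sets \<sigma>" for k
        unfolding D_def E_def sp[symmetric] by measurable
      have cover: "1 \<le> (\<Sum>k. indicator (D k) y) + (indicator E y :: ennreal)" if y: "y \<in> \<Omega>" for y
      proof (cases "y \<in> E")
        case False
        then have "v y \<le> ennreal t"
          using y by (simp add: E_def not_less)
        then obtain z where z: "v y = ennreal z" "0 \<le> z" "z \<le> t"
          using t by (cases "v y") (auto simp: top_unique)
        with v_pos[OF y] have "0 < z"
          by (cases "z = 0") auto
        then obtain k where "t / 2 ^ k / 2 < z" "z \<le> t / 2 ^ k"
          using dyadic_shell z by blast
        then have "y \<in> D k"
          using y z t by (simp add: D_def ennreal_less_iff ennreal_leI)
        then have "1 \<le> (\<Sum>k\<in>{k}. indicator (D k) y :: ennreal)"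
          by simp
        also have "\<dots> \<le> (\<Sum>k. indicator (D k) y)"
          by (rule sum_le_suminf) auto
        finally show ?thesis
          by (simp add: add_increasing2)
      qed (simp add: add_increasing)
      have shell: "(\<integral>\<^sup>+ y. indicator (D k) y * G x y \<partial>\<sigma>) \<le> ennreal (c * t powr (1 - q) * b ^ k)" for k
      proof -
        have "(\<integral>\<^sup>+ y. indicator (D k) y * G x y \<partial>\<sigma>) \<le> ennreal (h * 2 powr q * (t / 2 ^ k) powr (1 - q))"
          unfolding D_def v_def by (rule potential_shell_le[OF \<sigma> u]) (use assms t x le in auto)
        also have "(t / 2 ^ k) powr (1 - q) = t powr (1 - q) * b ^ k"
        proof (induction k)
          case (Suc k)
          have "(t / 2 ^ Suc k) powr (1 - q) = (t / 2 ^ k) powr (1 - q) * b"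
            using t unfolding b_def by (subst powr_mult[symmetric]) (auto simp: mult.commute)
          with Suc show ?case
            by simp
        qed simp
        finally show ?thesis
          by (simp add: c_def mult.assoc)
      qed
      \<comment> \<open>On \<open>E\<close> the factor t^(-q) u^q is at least 1, and the potential
        of u^q d\<sigma> at \<open>x\<close> is exactly \<open>t\<close>.\<close>
      have tail: "(\<integral>\<^sup>+ y. indicator E y * G x y \<partial>\<sigma>) \<le> ennreal (t powr (1 - q))"
      proof -
        have "(\<integral>\<^sup>+ y. indicator E y * G x y \<partial>\<sigma>) \<le> (\<integral>\<^sup>+ y. ennreal (t powr (- q)) * (epowr (u y) q * G x y) \<partial>\<sigma>)"
        proof (intro nn_integral_mono)
          fix y
          have "1 \<le> ennreal (t powr (- q)) * epowr (u y) q" if "y \<in> E"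
          proof -
            have "ennreal t \<le> u y"
              using that le[of y] by (auto simp: E_def v_def intro: order_trans less_imp_le)
            from epowr_mono[OF this, of q] have "ennreal (t powr q) \<le> epowr (u y) q"
              using t assms by (simp add: epowr_ennreal)
            then have "ennreal (t powr (- q)) * ennreal (t powr q) \<le> ennreal (t powr (- q)) * epowr (u y) q"
              by (intro mult_left_mono) auto
            then show ?thesis
              using t by (simp add: ennreal_mult[symmetric] powr_add[symmetric])
          qed
          then show "indicator E y * G x y \<le> ennreal (t powr (- q)) * (epowr (u y) q * G x y)"
            using mult_right_mono[of 1 "ennreal (t powr (- q)) * epowr (u y) q" "G x y"]
            by (auto simp: indicator_def mult.assoc)
        qed
        also have "\<dots> = ennreal (t powr (- q)) * (\<integral>\<^sup>+ y. epowr (u y) q * G x y \<partial>\<sigma>)"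
          by (intro nn_integral_cmult) measurable
        also have "(\<integral>\<^sup>+ y. epowr (u y) q * G x y \<partial>\<sigma>) = ennreal t"
          using real unfolding v_def by (subst (asm) potential_density[OF sets _ x]) auto
        also have "ennreal (t powr (- q)) * ennreal t = ennreal (t powr (1 - q))"
          using t by (simp add: ennreal_mult[symmetric] powr_diff powr_minus field_simps)
        finally show ?thesis .
      qed
      have "potential G \<sigma> x \<le> (\<integral>\<^sup>+ y. (\<Sum>k. indicator (D k) y * G x y) + indicator E y * G x y \<partial>\<sigma>)"
        unfolding potential_def
      proof (intro nn_integral_mono)
        fix y assume "y \<in> space \<sigma>"
        then have "1 * G x y \<le> ((\<Sum>k. indicator (D k) y) + indicator E y) * G x y"
          using cover sp by (intro mult_right_mono) auto
        then show "G x y \<le> (\<Sum>k. indicator (D k) y * G x y) + indicator E y * G x y"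
          by (simp add: distrib_right)
      qed
      also have "\<dots> = (\<Sum>k. (\<integral>\<^sup>+ y. indicator (D k) y * G x y \<partial>\<sigma>)) + (\<integral>\<^sup>+ y. indicator E y * G x y \<partial>\<sigma>)"
        by (subst nn_integral_add) (auto simp: nn_integral_suminf simp del: ennreal_suminf_multc)
      also have "\<dots> \<le> (\<Sum>k. ennreal (c * t powr (1 - q) * b ^ k)) + ennreal (t powr (1 - q))"
        using shell tail by (intro add_mono suminf_le) auto
      also have "(\<Sum>k. ennreal (c * t powr (1 - q) * b ^ k)) = ennreal (\<Sum>k. c * t powr (1 - q) * b ^ k)"
        using b c by (intro suminf_ennreal2 summable_mult summable_geometric) auto
      also have "(\<Sum>k. c * t powr (1 - q) * b ^ k) = c * t powr (1 - q) * (1 / (1 - b))"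
        using b by (simp add: suminf_mult suminf_geometric summable_geometric)
      also have "ennreal (c * t powr (1 - q) * (1 / (1 - b))) + ennreal (t powr (1 - q)) = ennreal C * epowr (v x) (1 - q)"
      proof -
        have "c * t powr (1 - q) * (1 / (1 - b)) + t powr (1 - q) = C * t powr (1 - q)"
          by (simp add: C_def algebra_simps)
        moreover have "0 \<le> c * t powr (1 - q) * (1 / (1 - b))"
          using b c by simp
        ultimately show ?thesis
          using C t real by (simp add: epowr_ennreal ennreal_mult[symmetric] del: ennreal_plus flip: ennreal_plus)
      qed
      also have "\<dots> \<le> ennreal C * epowr (u x) (1 - q)"
        using le[OF x] assms by (intro mult_left_mono epowr_mono) (auto simp: v_def)
      finally show ?thesis .
    qed
  qed
  with C show ?thesis
    using that by blast
qed

end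

section \<open>Energy estimates for quasi-symmetric kernels\<close>

locale quasi_symmetric_wmp_kernel = wmp_kernel +
  fixes a :: real
  assumes a_pos: "0 < a"
    and quasi_sym: "\<And>x y. x \<in> \<Omega> \<Longrightarrow> y \<in> \<Omega> \<Longrightarrow> G x y \<le> ennreal a * G y x"
begin

text \<open>On the left-hand set \<open>E\<close>, \<open>t\<close> is at most twice the potential
  of \<mu> restricted to the right-hand set \<open>F\<close>. Integration over \<open>E\<close>,
  Tonelli's theorem and quasi-symmetry turn this into the potential of \<nu> restricted to
  \<open>E\<close>, integrated over \<open>F\<close>; \<open>potential_sublevel_le\<close> bounds
  that potential by \<open>h * s\<close>.\<close>

lemma level_set_estimate:
  assumes \<mu>: "\<mu> \<in> \<M>\<^sup>+ \<Omega>" and \<nu>: "\<nu> \<in> \<M>\<^sup>+ \<Omega>" and "0 < t" "0 < s"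
  shows "ennreal t * emeasure \<nu> {x \<in> \<Omega>. ennreal t < potential G \<mu> x \<and> potential G \<nu> x \<le> ennreal s}
    \<le> ennreal (2 * a * h * s) * emeasure \<mu> {x \<in> \<Omega>. ennreal (t / (2 * h)) < potential G \<mu> x}"
proof -
  note sets = borel_measuresD(2)[OF \<mu>] borel_measuresD(2)[OF \<nu>]
  note sp = borel_measuresD(1)[OF \<mu>] borel_measuresD(1)[OF \<nu>]
  interpret \<mu>: sigma_finite_measure \<mu>
    by (rule sigma_finite_borel_measures[OF \<mu> open_\<Omega>])
  interpret \<nu>: sigma_finite_measure \<nu>
    by (rule sigma_finite_borel_measures[OF \<nu> open_\<Omega>])
  interpret P: pair_sigma_finite \<nu> \<mu> ..
  define E where "E = {x \<in> \<Omega>. ennreal t < potential G \<mu> x \<and> potential G \<nu> x \<le> ennreal s}"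
  define F where "F = {x \<in> \<Omega>. ennreal (t / (2 * h)) < potential G \<mu> x}"
  note [measurable] = measurable_potential'[OF sets(1) sets(1)] measurable_potential'[OF sets(2) sets(2)]
    measurable_potential'[OF sets(1) sets(2)]
  have [measurable]: "E \<in> sets \<nu>"
    unfolding E_def sp(2)[symmetric] by measurable
  have [measurable]: "F \<in> sets \<mu>"
    unfolding F_def sp(1)[symmetric] by measurable
  have [measurable]: "(\<lambda>z. G (fst z) (snd z)) \<in> borel_measurable (\<nu> \<Otimes>\<^sub>M \<mu>)"
    using measurable_kernel_pair
    by (simp add: split_beta' measurable_cong_sets[OF sets_pair_measure_cong[OF sets(2) sets(1)] refl])
  have "ennreal t * emeasure \<nu> E = (\<integral>\<^sup>+ x. ennreal t * indicator E x \<partial>\<nu>)"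
    by (simp add: nn_integral_cmult_indicator)
  also have "\<dots> \<le> (\<integral>\<^sup>+ x. 2 * (\<integral>\<^sup>+ y. indicator E x * indicator F y * G x y \<partial>\<mu>) \<partial>\<nu>)"
  proof (intro nn_integral_mono)
    fix x
    show "ennreal t * indicator E x \<le> 2 * (\<integral>\<^sup>+ y. indicator E x * indicator F y * G x y \<partial>\<mu>)"
    proof (cases "x \<in> E")
      case True
      then have x: "x \<in> \<Omega>" "ennreal t \<le> potential G \<mu> x"
        by (auto simp: E_def)
      have "potential G \<mu> x \<le> 2 * (\<integral>\<^sup>+ y. indicator F y * G x y \<partial>\<mu>)"
        unfolding F_def using x \<open>0 < t\<close> h_ge_1 by (intro potential_le_superlevel[OF \<mu>]) auto
      with x True show ?thesis
        by simp
    qed simp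
  qed
  also have "\<dots> = 2 * (\<integral>\<^sup>+ x. (\<integral>\<^sup>+ y. indicator E x * indicator F y * G x y \<partial>\<mu>) \<partial>\<nu>)"
    by (intro nn_integral_cmult) measurable
  also have "(\<integral>\<^sup>+ x. (\<integral>\<^sup>+ y. indicator E x * indicator F y * G x y \<partial>\<mu>) \<partial>\<nu>) =
      (\<integral>\<^sup>+ y. (\<integral>\<^sup>+ x. indicator E x * indicator F y * G x y \<partial>\<nu>) \<partial>\<mu>)"
    by (intro P.Fubini'[symmetric]) (simp add: split_beta')
  also have "\<dots> \<le> (\<integral>\<^sup>+ y. ennreal (a * h * s) * indicator F y \<partial>\<mu>)"
  proof (intro nn_integral_mono)
    fix y assume "y \<in> space \<mu>"
    show "(\<integral>\<^sup>+ x. indicator E x * indicator F y * G x y \<partial>\<nu>) \<le> ennreal (a * h * s) * indicator F y"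
    proof (cases "y \<in> F")
      case True
      then have y: "y \<in> \<Omega>"
        by (simp add: F_def)
      note [measurable] = measurable_kernel[OF sets(2) y]
      have "(\<integral>\<^sup>+ x. indicator E x * indicator F y * G x y \<partial>\<nu>) \<le> (\<integral>\<^sup>+ x. ennreal a * (indicator E x * G y x) \<partial>\<nu>)"
        using True quasi_sym[OF _ y] by (intro nn_integral_mono) (auto simp: E_def indicator_def)
      also have "\<dots> = ennreal a * (\<integral>\<^sup>+ x. indicator E x * G y x \<partial>\<nu>)"
        by (intro nn_integral_cmult) measurable
      also have "\<dots> = ennreal a * potential G (density \<nu> (indicator E)) y"
        by (subst potential_density[OF sets(2) _ y]) simp_all
      also have "\<dots> \<le> ennreal a * ennreal (h * s)"
        using \<open>0 < s\<close> y
        by (intro mult_left_mono potential_sublevel_le[OF \<nu> \<open>E \<in> sets \<nu>\<close>]) (auto simp: E_def)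
      finally show ?thesis
        using True a_pos h_ge_1 \<open>0 < s\<close> by (simp add: ennreal_mult[symmetric] mult.assoc)
    qed simp
  qed
  also have "\<dots> = ennreal (a * h * s) * emeasure \<mu> F"
    by (simp add: nn_integral_cmult_indicator)
  finally have "ennreal t * emeasure \<nu> E \<le> 2 * (ennreal (a * h * s) * emeasure \<mu> F)"
    by (simp add: mult_left_mono)
  also have "\<dots> = ennreal (2 * a * h * s) * emeasure \<mu> F"
    using a_pos h_ge_1 \<open>0 < s\<close> by (simp add: ennreal_mult mult.assoc)
  finally show ?thesis
    by (simp add: E_def F_def)
qed

text \<open>The factor 2 a h comes from \<open>level_set_estimate\<close>, the quotient from
  exchanging the layer-cake weight of exponent \<gamma> + q for that of exponent \<gamma>, and the
  power of 2 h from the lower level t / (2 h).\<close>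

definition energy_const :: "real \<Rightarrow> real \<Rightarrow> real" where
  "energy_const \<gamma> q = 2 * a * h * ((\<gamma> + q) / \<gamma>) * (2 * h) powr \<gamma>"

lemma energy_const_pos: "0 < \<gamma> \<Longrightarrow> 0 < q \<Longrightarrow> 0 < energy_const \<gamma> q"
  using a_pos h_ge_1 by (simp add: energy_const_def)

text \<open>Where L (\<G>\<sigma>)^(1/(1-q)) does not exceed \<open>t\<close>, the potential of
  \<sigma> is at most \<open>s\<close>, and \<open>level_set_estimate\<close> applies with \<nu> =
  \<sigma>. The cap \<open>N\<close> leaves the sets unchanged for t < N and empties the left one
  otherwise.\<close>

lemma superlevel_estimate:
  fixes q L t :: real and N :: ennreal
  assumes \<mu>: "\<mu> \<in> \<M>\<^sup>+ \<Omega>" and \<sigma>: "\<sigma> \<in> \<M>\<^sup>+ \<Omega>" and q: "0 < q" "q < 1" and L: "0 < L" and t: "0 < t"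
  shows "emeasure \<sigma> {x \<in> \<Omega>. ennreal t < min (potential G \<mu> x) N} \<le>
      emeasure \<sigma> {x \<in> \<Omega>. ennreal t < ennreal L * epowr (potential G \<sigma> x) (1 / (1 - q))} +
      ennreal (2 * a * h * t powr (- q) * L powr (q - 1)) *
        emeasure \<mu> {x \<in> \<Omega>. ennreal t < min (ennreal (2 * h) * potential G \<mu> x) N}"
proof (cases "ennreal t < N")
  case True
  note sets = borel_measuresD(2)[OF \<mu>] borel_measuresD(2)[OF \<sigma>]
  note sp = borel_measuresD(1)[OF \<mu>] borel_measuresD(1)[OF \<sigma>]
  note [measurable] = measurable_potential'[OF sets(2) sets(2)] measurable_potential'[OF sets(1) sets(2)]
  \<comment> \<open>Chosen so that L s^(1/(1-q)) = t.\<close>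
  define s where "s = (t / L) powr (1 - q)"
  let ?W = "{x \<in> \<Omega>. ennreal t < ennreal L * epowr (potential G \<sigma> x) (1 / (1 - q))}"
  let ?E = "{x \<in> \<Omega>. ennreal t < potential G \<mu> x \<and> potential G \<sigma> x \<le> ennreal s}"
  have "{x \<in> \<Omega>. ennreal t < min (potential G \<mu> x) N} \<subseteq> ?W \<union> ?E"
  proof
    fix x assume x: "x \<in> {x \<in> \<Omega>. ennreal t < min (potential G \<mu> x) N}"
    have "potential G \<sigma> x \<le> ennreal s" if "ennreal L * epowr (potential G \<sigma> x) (1 / (1 - q)) \<le> ennreal t"
    proof -
      have "ennreal (1 / L) * (ennreal L * epowr (potential G \<sigma> x) (1 / (1 - q))) \<le> ennreal (1 / L) * ennreal t"
        using that by (intro mult_left_mono) auto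
      then have "epowr (potential G \<sigma> x) (1 / (1 - q)) \<le> ennreal (t / L)"
        using L t by (simp add: mult.assoc[symmetric] ennreal_mult[symmetric])
      then have "potential G \<sigma> x \<le> epowr (ennreal (t / L)) (1 - q)"
        using q by (simp add: epowr_le_iff)
      then show ?thesis
        using L t by (simp add: epowr_ennreal s_def)
    qed
    with x show "x \<in> ?W \<union> ?E"
      by (cases "ennreal L * epowr (potential G \<sigma> x) (1 / (1 - q)) \<le> ennreal t") (auto simp: not_le)
  qed
  moreover have [measurable]: "?W \<in> sets \<sigma>" "?E \<in> sets \<sigma>"
    unfolding sp(2)[symmetric] by measurable
  ultimately have "emeasure \<sigma> {x \<in> \<Omega>. ennreal t < min (potential G \<mu> x) N} \<le> emeasure \<sigma> ?W + emeasure \<sigma> ?E"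
    by (meson emeasure_mono emeasure_subadditive order_trans sets.Un)
  moreover have "emeasure \<sigma> ?E \<le> ennreal (2 * a * h * t powr (- q) * L powr (q - 1)) *
        emeasure \<mu> {x \<in> \<Omega>. ennreal t < min (ennreal (2 * h) * potential G \<mu> x) N}"
  proof -
    have F: "{x \<in> \<Omega>. ennreal (t / (2 * h)) < potential G \<mu> x} =
        {x \<in> \<Omega>. ennreal t < min (ennreal (2 * h) * potential G \<mu> x) N}"
    proof -
      have "ennreal (t / (2 * h)) < p \<longleftrightarrow> ennreal t < ennreal (2 * h) * p" for p
      proof (cases p)
        case (real r)
        then show ?thesis
          using t h_ge_1 by (simp add: ennreal_mult[symmetric] ennreal_less_iff field_simps)
      qed (use h_ge_1 in \<open>auto simp: ennreal_mult_top\<close>)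
      with True show ?thesis
        by auto
    qed
    have "emeasure \<sigma> ?E = ennreal (1 / t) * (ennreal t * emeasure \<sigma> ?E)"
      using t by (simp add: mult.assoc[symmetric] ennreal_mult[symmetric])
    also have "\<dots> \<le> ennreal (1 / t) * (ennreal (2 * a * h * s) * emeasure \<mu> {x \<in> \<Omega>. ennreal (t / (2 * h)) < potential G \<mu> x})"
      using t L by (intro mult_left_mono level_set_estimate \<mu> \<sigma>) (auto simp: s_def)
    also have "\<dots> = ennreal (1 / t * (2 * a * h * s)) * emeasure \<mu> {x \<in> \<Omega>. ennreal (t / (2 * h)) < potential G \<mu> x}"
      using t a_pos h_ge_1 by (simp add: mult.assoc[symmetric] ennreal_mult[symmetric] s_def)
    also have "1 / t * (2 * a * h * s) = 2 * a * h * t powr (- q) * L powr (q - 1)"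
      using t L by (simp add: s_def powr_divide powr_diff powr_minus field_simps)
    finally show ?thesis
      unfolding F .
  qed
  ultimately show ?thesis
    by (meson add_left_mono order_trans)
next
  case False
  then show ?thesis
    by simp
qed

text \<open>The truncation level \<open>N\<close> makes the left-hand side finite, so that it can later be absorbed.\<close>

lemma potential_energy_estimate:
  fixes q \<gamma> L :: real and N :: ennreal
  assumes \<mu>: "\<mu> \<in> \<M>\<^sup>+ \<Omega>" and \<sigma>: "\<sigma> \<in> \<M>\<^sup>+ \<Omega>" and q: "0 < q" "q < 1" and \<gamma>: "0 < \<gamma>" and L: "0 < L"
  shows "(\<integral>\<^sup>+ x. epowr (min (potential G \<mu> x) N) (\<gamma> + q) \<partial>\<sigma>) \<le>
      ennreal (L powr (\<gamma> + q)) * (\<integral>\<^sup>+ x. epowr (potential G \<sigma> x) ((\<gamma> + q) / (1 - q)) \<partial>\<sigma>) +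
      ennreal (energy_const \<gamma> q * L powr (q - 1)) * (\<integral>\<^sup>+ x. epowr (min (potential G \<mu> x) N) \<gamma> \<partial>\<mu>)"
proof -
  note sets = borel_measuresD(2)[OF \<mu>] borel_measuresD(2)[OF \<sigma>]
  note sp = borel_measuresD(1)[OF \<mu>] borel_measuresD(1)[OF \<sigma>]
  have sf: "sigma_finite_measure \<mu>" "sigma_finite_measure \<sigma>"
    by (rule sigma_finite_borel_measures[OF _ open_\<Omega>], fact)+
  interpret \<mu>: sigma_finite_measure \<mu> by fact
  interpret \<sigma>: sigma_finite_measure \<sigma> by fact
  note [measurable] = measurable_potential'[OF sets(1) sets(1)] measurable_potential'[OF sets(2) sets(2)]
    measurable_potential'[OF sets(1) sets(2)]
  define r where "r = \<gamma> + q"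
  have r: "0 < r"
    using q \<gamma> by (simp add: r_def)
  define F where "F = (\<lambda>x. min (potential G \<mu> x) N)"
  define F' where "F' = (\<lambda>x. min (ennreal (2 * h) * potential G \<mu> x) N)"
  define W where "W = (\<lambda>x. ennreal L * epowr (potential G \<sigma> x) (1 / (1 - q)))"
  have [measurable]: "F \<in> borel_measurable \<sigma>" "F \<in> borel_measurable \<mu>" "F' \<in> borel_measurable \<mu>" "W \<in> borel_measurable \<sigma>"
    unfolding F_def F'_def W_def by measurable
  define c where "c = 2 * a * h * L powr (q - 1) * (r / \<gamma>)"
  have c: "0 \<le> c"
    using a_pos h_ge_1 r \<gamma> by (simp add: c_def)
  let ?d = "\<lambda>p t. ennreal (p * t powr (p - 1)) * indicator {0<..} t"
  have "(\<integral>\<^sup>+ x. epowr (F x) r \<partial>\<sigma>) = (\<integral>\<^sup>+ t. ?d r t * emeasure \<sigma> {x \<in> space \<sigma>. ennreal t < F x} \<partial>lborel)"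
    by (rule nn_integral_epowr_layer_cake[OF sf(2) _ r]) measurable
  also have "\<dots> \<le> (\<integral>\<^sup>+ t. ?d r t * emeasure \<sigma> {x \<in> space \<sigma>. ennreal t < W x} +
      ennreal c * (?d \<gamma> t * emeasure \<mu> {x \<in> space \<mu>. ennreal t < F' x}) \<partial>lborel)"
  proof (intro nn_integral_mono)
    fix t :: real
    show "?d r t * emeasure \<sigma> {x \<in> space \<sigma>. ennreal t < F x} \<le> ?d r t * emeasure \<sigma> {x \<in> space \<sigma>. ennreal t < W x} +
      ennreal c * (?d \<gamma> t * emeasure \<mu> {x \<in> space \<mu>. ennreal t < F' x})"
    proof (cases "0 < t")
      case True
      let ?k = "2 * a * h * t powr (- q) * L powr (q - 1)"
      have "?d r t * emeasure \<sigma> {x \<in> space \<sigma>. ennreal t < F x} \<le> ?d r t *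
          (emeasure \<sigma> {x \<in> space \<sigma>. ennreal t < W x} + ennreal ?k * emeasure \<mu> {x \<in> space \<mu>. ennreal t < F' x})"
        unfolding sp F_def F'_def W_def using superlevel_estimate[OF \<mu> \<sigma> q L True] by (intro mult_left_mono) auto
      also have "\<dots> = ?d r t * emeasure \<sigma> {x \<in> space \<sigma>. ennreal t < W x} +
          ennreal (r * t powr (r - 1) * ?k) * emeasure \<mu> {x \<in> space \<mu>. ennreal t < F' x}"
        using True r a_pos h_ge_1 by (simp add: distrib_left ennreal_mult mult.assoc)
      also have "r * t powr (r - 1) * ?k = c * (\<gamma> * t powr (\<gamma> - 1))"
      proof -
        \<comment> \<open>The factor t^(-q) of the level-set comparison lowers the exponent from
          \<gamma> + q to \<gamma>, so the second integral is a layer-cake formula for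
          \<mu>.\<close>
        have "t powr (r - 1) * t powr (- q) = t powr (\<gamma> - 1)"
          using True by (simp add: powr_add[symmetric] r_def)
        then show ?thesis
          using \<gamma> by (simp add: c_def)
      qed
      finally show ?thesis
        using True c \<gamma> by (simp add: ennreal_mult mult.assoc)
    qed simp
  qed
  also have "\<dots> = (\<integral>\<^sup>+ t. ?d r t * emeasure \<sigma> {x \<in> space \<sigma>. ennreal t < W x} \<partial>lborel) +
      ennreal c * (\<integral>\<^sup>+ t. ?d \<gamma> t * emeasure \<mu> {x \<in> space \<mu>. ennreal t < F' x} \<partial>lborel)"
    by (subst nn_integral_add) (auto simp: nn_integral_cmult)
  also have "\<dots> = (\<integral>\<^sup>+ x. epowr (W x) r \<partial>\<sigma>) + ennreal c * (\<integral>\<^sup>+ x. epowr (F' x) \<gamma> \<partial>\<mu>)"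
    by (subst (1 2) nn_integral_epowr_layer_cake) (use sf r \<gamma> in auto)
  also have "(\<integral>\<^sup>+ x. epowr (W x) r \<partial>\<sigma>) =
      ennreal (L powr r) * (\<integral>\<^sup>+ x. epowr (potential G \<sigma> x) (r / (1 - q)) \<partial>\<sigma>)"
    unfolding W_def using L by (simp add: epowr_mult epowr_epowr epowr_ennreal nn_integral_cmult)
  also have "(\<integral>\<^sup>+ x. epowr (F' x) \<gamma> \<partial>\<mu>) \<le> (\<integral>\<^sup>+ x. ennreal ((2 * h) powr \<gamma>) * epowr (F x) \<gamma> \<partial>\<mu>)"
  proof (intro nn_integral_mono)
    fix x
    \<comment> \<open>Because 2 h \<ge> 1, capping after the dilation by 2 h gives no more than
      dilating the capped function.\<close>
    have "N \<le> ennreal (2 * h) * N"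
      using mult_right_mono[of 1 "ennreal (2 * h)" N] h_ge_1 by simp
    then have "F' x \<le> ennreal (2 * h) * F x"
      by (auto simp: F_def F'_def min_def intro: order_trans)
    from epowr_mono[OF this, of \<gamma>] show "epowr (F' x) \<gamma> \<le> ennreal ((2 * h) powr \<gamma>) * epowr (F x) \<gamma>"
      using \<gamma> h_ge_1 by (simp add: epowr_mult epowr_ennreal)
  qed
  also have "\<dots> = ennreal ((2 * h) powr \<gamma>) * (\<integral>\<^sup>+ x. epowr (F x) \<gamma> \<partial>\<mu>)"
    by (intro nn_integral_cmult) measurable
  also have "ennreal c * \<dots> = ennreal (energy_const \<gamma> q * L powr (q - 1)) * (\<integral>\<^sup>+ x. epowr (F x) \<gamma> \<partial>\<mu>)"
  proof -
    have "c * (2 * h) powr \<gamma> = energy_const \<gamma> q * L powr (q - 1)"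
      by (simp add: c_def energy_const_def r_def)
    then show ?thesis
      using c by (simp add: mult.assoc[symmetric] ennreal_mult[symmetric])
  qed
  finally show ?thesis
    by (simp add: r_def F_def mult_left_mono add_left_mono)
qed

text \<open>Since q < 1, L^(q-1) takes every positive value. A small \<eta> is paid for by a large
  factor on the term with the potential of \<sigma>.\<close>

lemma ex_absorbing_level:
  assumes "0 < \<gamma>" "0 < q" "q < 1" "0 < \<eta>"
  obtains L where "0 < L" "energy_const \<gamma> q * L powr (q - 1) = \<eta>"
proof
  have pos: "0 < energy_const \<gamma> q"
    using assms by (intro energy_const_pos)
  then show "0 < (energy_const \<gamma> q / \<eta>) powr (1 / (1 - q))"
    using assms by simp
  have "1 / (1 - q) * (q - 1) = - 1"
    using assms by (simp add: field_simps)
  then show "energy_const \<gamma> q * ((energy_const \<gamma> q / \<eta>) powr (1 / (1 - q))) powr (q - 1) = \<eta>"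
    using assms pos by (simp add: powr_powr powr_minus)
qed

section \<open>Bounds for potentials of u^q d\<sigma>\<close>

text \<open>By \<open>energy_le\<close>, the energy estimate for u^q d\<sigma> has its own left-hand
  side on the right with a factor at most 1/2, which is absorbed after truncation; the bound
  survives the limit. As \<open>C\<close> is independent of \<open>u\<close>, it can serve a whole
  iteration.\<close>

lemma potential_Lp_diagonal:
  fixes q \<gamma> \<delta> :: real
  assumes \<sigma>: "\<sigma> \<in> \<M>\<^sup>+ \<Omega>" and q: "0 < q" "q < 1" and \<gamma>: "0 < \<gamma>" and \<delta>: "0 < \<delta>"
    and A: "in_Lp ((\<gamma> + q) / (1 - q)) \<sigma> (potential G \<sigma>)"
  obtains C :: ennreal where "C < top"
    "\<And>u. u \<in> borel_measurable \<sigma> \<Longrightarrow> (\<integral>\<^sup>+ x. epowr (potential G (density \<sigma> (\<lambda>y. epowr (u y) q)) x) (\<gamma> + q) \<partial>\<sigma>)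
      \<le> C + ennreal \<delta> * (\<integral>\<^sup>+ x. epowr (u x) (\<gamma> + q) \<partial>\<sigma>)"
proof -
  note sets = borel_measuresD(2)[OF \<sigma>]
  have sp: "space \<sigma> = \<Omega>"
    by (rule borel_measuresD(1)[OF \<sigma>])
  define r where "r = \<gamma> + q"
  have r: "0 < r"
    using q \<gamma> by (simp add: r_def)
  \<comment> \<open>\<eta> \<le> 1/2 permits absorption, which doubles \<eta>; 2 \<eta> \<le>
    \<delta> gives the factor claimed.\<close>
  define \<eta> where "\<eta> = min (\<delta> / 2) (1 / 2)"
  have \<eta>: "0 < \<eta>" "\<eta> \<le> 1 / 2" "2 * \<eta> \<le> \<delta>"
    using \<delta> by (auto simp: \<eta>_def)
  obtain L where L: "0 < L" "energy_const \<gamma> q * L powr (q - 1) = \<eta>"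
    using ex_absorbing_level[OF \<gamma> q \<eta>(1)] .
  define B where "B = ennreal (L powr r) * (\<integral>\<^sup>+ x. epowr (potential G \<sigma> x) (r / (1 - q)) \<partial>\<sigma>)"
  have B: "B < top"
    using A by (auto simp: B_def in_Lp_def r_def ennreal_mult_less_top)
  obtain C :: "nat \<Rightarrow> 'a set" where C: "\<And>n. compact (C n)" "incseq C" "(\<Union>n. C n) = \<Omega>"
    using open_exhausted_by_compacts[OF open_\<Omega>] by blast
  then have C_sub: "C n \<subseteq> \<Omega>" for n
    by auto
  have [measurable]: "C n \<in> sets \<sigma>" for n
    by (rule compact_in_sets_borel_measures[OF \<sigma> open_\<Omega> C(1) C_sub])
  have "(\<integral>\<^sup>+ x. epowr (potential G (density \<sigma> (\<lambda>y. epowr (u y) q)) x) r \<partial>\<sigma>)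
      \<le> 2 * B + ennreal \<delta> * (\<integral>\<^sup>+ x. epowr (u x) r \<partial>\<sigma>)" if u [measurable]: "u \<in> borel_measurable \<sigma>" for u
  \<comment> \<open>If this integral is infinite, so is the right-hand side. Otherwise
    \<open>u\<close> is locally in L^q and u^q d\<sigma> is locally finite.\<close>
  proof (cases "(\<integral>\<^sup>+ x. epowr (u x) r \<partial>\<sigma>) < top")
    case False
    then show ?thesis
      using \<delta> by (simp add: top_unique not_less ennreal_mult_top)
  next
    case True
    define X where "X = (\<integral>\<^sup>+ x. epowr (u x) r \<partial>\<sigma>)"
    have "in_Lp r \<sigma> u"
      using True by (simp add: in_Lp_def)
    then have "in_Lp_loc q \<sigma> u"
      using q \<gamma> by (intro in_Lp_loc_if_in_Lp[OF \<sigma> open_\<Omega>]) (auto simp: r_def)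
    then have uq: "density \<sigma> (\<lambda>y. epowr (u y) q) \<in> \<M>\<^sup>+ \<Omega>"
      by (rule density_epowr_in_borel_measures[OF \<sigma> open_\<Omega>])
    \<comment> \<open>\<sigma> is restricted along with the density, so that \<open>Y n\<close> is
      at most n^r \<sigma>(C n), which is finite.\<close>
    define \<sigma>' where "\<sigma>' n = density \<sigma> (indicator (C n))" for n
    define \<mu> where "\<mu> n = density \<sigma> (\<lambda>y. indicator (C n) y * epowr (u y) q)" for n
    define F where "F n x = min (potential G (\<mu> n) x) (ennreal (real n))" for n x
    have \<sigma>': "\<sigma>' n \<in> \<M>\<^sup>+ \<Omega>" for n
      unfolding \<sigma>'_def by (rule density_indicator_in_borel_measures[OF \<sigma> open_\<Omega>]) measurable
    have \<mu>: "\<mu> n \<in> \<M>\<^sup>+ \<Omega>" for n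
      unfolding \<mu>_def by (rule density_le_in_borel_measures[OF \<sigma> open_\<Omega> _ _ uq]) (auto simp: indicator_def)
    have [measurable]: "F n \<in> borel_measurable \<sigma>" for n
      unfolding F_def using measurable_potential'[OF borel_measuresD(2)[OF \<mu>] sets] by measurable
    define Y where "Y n = (\<integral>\<^sup>+ x. epowr (F n x) r \<partial>\<sigma>' n)" for n
    have Y: "Y n \<le> 2 * B + ennreal (2 * \<eta>) * X" for n
    proof (rule ennreal_absorb)
      have "Y n \<le> ennreal (L powr r) * (\<integral>\<^sup>+ x. epowr (potential G (\<sigma>' n) x) (r / (1 - q)) \<partial>\<sigma>' n) +
          ennreal \<eta> * (\<integral>\<^sup>+ x. epowr (F n x) \<gamma> \<partial>\<mu> n)"
        unfolding Y_def F_def r_def L(2)[symmetric] by (rule potential_energy_estimate[OF \<mu> \<sigma>' q \<gamma> L(1)])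
      also have "\<dots> \<le> B + ennreal \<eta> * (Y n + X)"
      proof (intro add_mono mult_left_mono)
        have "(\<integral>\<^sup>+ x. epowr (potential G (\<sigma>' n) x) (r / (1 - q)) \<partial>\<sigma>' n) =
            (\<integral>\<^sup>+ x. indicator (C n) x * epowr (potential G (\<sigma>' n) x) (r / (1 - q)) \<partial>\<sigma>)"
          unfolding \<sigma>'_def using measurable_potential'[OF _ sets, of "density \<sigma> (indicator (C n))"] sets
          by (subst nn_integral_density) auto
        also have "\<dots> \<le> (\<integral>\<^sup>+ x. epowr (potential G \<sigma> x) (r / (1 - q)) \<partial>\<sigma>)"
        proof (intro nn_integral_mono)
          fix x assume "x \<in> space \<sigma>"
          then have "potential G (\<sigma>' n) x \<le> potential G (density \<sigma> (\<lambda>_. 1)) x"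
            unfolding \<sigma>'_def by (intro potential_mono_density sets) (auto simp: sp indicator_def)
          then have "epowr (potential G (\<sigma>' n) x) (r / (1 - q)) \<le> epowr (potential G \<sigma> x) (r / (1 - q))"
            using r q by (intro epowr_mono) (auto simp: density_1)
          then show "indicator (C n) x * epowr (potential G (\<sigma>' n) x) (r / (1 - q)) \<le> epowr (potential G \<sigma> x) (r / (1 - q))"
            by (auto simp: indicator_def)
        qed
        finally show "ennreal (L powr r) * (\<integral>\<^sup>+ x. epowr (potential G (\<sigma>' n) x) (r / (1 - q)) \<partial>\<sigma>' n) \<le> B"
          unfolding B_def by (intro mult_left_mono) auto
        have "(\<integral>\<^sup>+ x. epowr (F n x) \<gamma> \<partial>\<mu> n) \<le> Y n + (\<integral>\<^sup>+ x. indicator (C n) x * epowr (u x) r \<partial>\<sigma>)"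
          unfolding \<mu>_def Y_def \<sigma>'_def r_def
          by (rule energy_le[OF sets]) (use \<gamma> q in \<open>auto simp: indicator_def\<close>)
        also have "\<dots> \<le> Y n + X"
          unfolding X_def by (intro add_left_mono nn_integral_mono) (auto simp: indicator_def)
        finally show "(\<integral>\<^sup>+ x. epowr (F n x) \<gamma> \<partial>\<mu> n) \<le> Y n + X" .
      qed auto
      finally show "Y n \<le> B + ennreal \<eta> * (Y n + X)" .
      have "Y n \<le> (\<integral>\<^sup>+ x. ennreal (real n powr r) \<partial>\<sigma>' n)"
        unfolding Y_def using r epowr_mono[of "F n _" "ennreal (real n)" r]
        by (intro nn_integral_mono) (auto simp: F_def epowr_ennreal)
      also have "\<dots> = ennreal (real n powr r) * emeasure (\<sigma>' n) \<Omega>"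
        using borel_measuresD(1)[OF \<sigma>'] by simp
      also have "emeasure (\<sigma>' n) \<Omega> = emeasure \<sigma> (C n)"
      proof -
        have "emeasure (\<sigma>' n) \<Omega> = (\<integral>\<^sup>+ x. indicator (C n) x * indicator \<Omega> x \<partial>\<sigma>)"
          unfolding \<sigma>'_def by (intro emeasure_density) (auto simp flip: sp)
        also have "\<dots> = (\<integral>\<^sup>+ x. indicator (C n) x \<partial>\<sigma>)"
          by (intro nn_integral_cong) (simp add: sp)
        finally show ?thesis
          by simp
      qed
      also have "ennreal (real n powr r) * emeasure \<sigma> (C n) < top"
        using borel_measuresD(3)[OF \<sigma> C(1) C_sub] by (simp add: ennreal_mult_less_top)
      finally show "Y n < top" .
    qed (use \<eta> in auto)
    have "(\<integral>\<^sup>+ x. epowr (potential G (density \<sigma> (\<lambda>y. epowr (u y) q)) x) r \<partial>\<sigma>) =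
        (\<integral>\<^sup>+ x. (SUP n. epowr (indicator (C n) x * F n x) r) \<partial>\<sigma>)"
    proof (intro nn_integral_cong)
      fix x assume "x \<in> space \<sigma>"
      then have "(SUP n. indicator (C n) x * F n x) = potential G (density \<sigma> (\<lambda>y. epowr (u y) q)) x"
        unfolding F_def \<mu>_def using C(2,3) by (intro potential_truncation_SUP sets) (auto simp: sp)
      then show "epowr (potential G (density \<sigma> (\<lambda>y. epowr (u y) q)) x) r =
          (SUP n. epowr (indicator (C n) x * F n x) r)"
        using epowr_SUP[OF r, of "\<lambda>n. indicator (C n) x * F n x" UNIV] by simp
    qed
    also have "\<dots> = (SUP n. \<integral>\<^sup>+ x. epowr (indicator (C n) x * F n x) r \<partial>\<sigma>)"
    proof (rule nn_integral_monotone_convergence_SUP_AE)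
      fix n
      show "AE x in \<sigma>. epowr (indicator (C n) x * F n x) r \<le> epowr (indicator (C (Suc n)) x * F (Suc n) x) r"
      proof (rule AE_I2)
        fix x assume "x \<in> space \<sigma>"
        have sub: "C n \<subseteq> C (Suc n)"
          using C(2) by (simp add: incseq_SucD)
        have "potential G (\<mu> n) x \<le> potential G (\<mu> (Suc n)) x"
          unfolding \<mu>_def using \<open>x \<in> space \<sigma>\<close> sub
          by (intro potential_mono_density sets) (auto simp: sp indicator_def)
        then have "F n x \<le> F (Suc n) x"
          unfolding F_def by (intro min.mono) auto
        then show "epowr (indicator (C n) x * F n x) r \<le> epowr (indicator (C (Suc n)) x * F (Suc n) x) r"
          using sub r by (intro epowr_mono mult_mono) (auto simp: indicator_def)
      qed
    qed measurable
    also have "\<dots> \<le> 2 * B + ennreal (2 * \<eta>) * X"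
    proof (rule SUP_least)
      fix n
      have "(\<integral>\<^sup>+ x. epowr (indicator (C n) x * F n x) r \<partial>\<sigma>) = Y n"
        unfolding Y_def \<sigma>'_def by (subst nn_integral_density) (auto intro!: nn_integral_cong simp: indicator_def)
      then show "(\<integral>\<^sup>+ x. epowr (indicator (C n) x * F n x) r \<partial>\<sigma>) \<le> 2 * B + ennreal (2 * \<eta>) * X"
        using Y by simp
    qed
    also have "\<dots> \<le> 2 * B + ennreal \<delta> * X"
      using \<eta> by (intro add_left_mono mult_right_mono ennreal_leI) auto
    finally show ?thesis
      by (simp add: X_def)
  qed
  with B show ?thesis
    by (intro that[of "2 * B"]) (auto simp: r_def ennreal_mult_less_top)
qed

text \<open>The measures and exponents on the two sides may differ, so nothing is absorbed: the
  \<sigma>-integral that \<open>energy_le\<close> produces is bounded by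
  \<open>potential_Lp_diagonal\<close>.\<close>

lemma potential_Lp:
  fixes p q \<gamma> \<delta> :: real
  assumes \<sigma>: "\<sigma> \<in> \<M>\<^sup>+ \<Omega>" and q: "0 < q" "q < 1" and \<gamma>: "0 < \<gamma>" and \<delta>: "0 < \<delta>"
    and A: "in_Lp ((\<gamma> + q) / (1 - q)) \<sigma> (potential G \<sigma>)"
    and \<tau>: "\<tau> \<in> \<M>\<^sup>+ \<Omega>" and p: "0 < p" "p < 1" and A': "in_Lp ((\<gamma> + p) / (1 - p)) \<tau> (potential G \<tau>)"
  obtains C :: ennreal where "C < top"
    "\<And>u. u \<in> borel_measurable \<sigma> \<Longrightarrow> (\<integral>\<^sup>+ x. epowr (potential G (density \<sigma> (\<lambda>y. epowr (u y) q)) x) (\<gamma> + p) \<partial>\<tau>)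
      \<le> C + ennreal \<delta> * (\<integral>\<^sup>+ x. epowr (u x) (\<gamma> + q) \<partial>\<sigma>)"
proof -
  note sets = borel_measuresD(2)[OF \<sigma>]
  obtain D :: ennreal where D: "D < top"
    "\<And>u. u \<in> borel_measurable \<sigma> \<Longrightarrow> (\<integral>\<^sup>+ x. epowr (potential G (density \<sigma> (\<lambda>y. epowr (u y) q)) x) (\<gamma> + q) \<partial>\<sigma>)
      \<le> D + ennreal 1 * (\<integral>\<^sup>+ x. epowr (u x) (\<gamma> + q) \<partial>\<sigma>)"
    using potential_Lp_diagonal[OF \<sigma> q \<gamma> zero_less_one A] by blast
  \<comment> \<open>The factor \<delta> / 2 falls on two copies of the integral of \<open>u\<close>:
    one from \<open>energy_le\<close>, one from the diagonal bound with coefficient 1.\<close>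
  obtain L where L: "0 < L" "energy_const \<gamma> p * L powr (p - 1) = \<delta> / 2"
    using ex_absorbing_level[OF \<gamma> p, of "\<delta> / 2"] \<delta> by auto
  define B where "B = ennreal (L powr (\<gamma> + p)) * (\<integral>\<^sup>+ x. epowr (potential G \<tau> x) ((\<gamma> + p) / (1 - p)) \<partial>\<tau>)"
  have B: "B < top"
    using A' by (auto simp: B_def in_Lp_def ennreal_mult_less_top)
  have "(\<integral>\<^sup>+ x. epowr (potential G (density \<sigma> (\<lambda>y. epowr (u y) q)) x) (\<gamma> + p) \<partial>\<tau>)
      \<le> B + ennreal (\<delta> / 2) * D + ennreal \<delta> * (\<integral>\<^sup>+ x. epowr (u x) (\<gamma> + q) \<partial>\<sigma>)"
    if u [measurable]: "u \<in> borel_measurable \<sigma>" for u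
  proof (cases "(\<integral>\<^sup>+ x. epowr (u x) (\<gamma> + q) \<partial>\<sigma>) < top")
    case False
    then show ?thesis
      using \<delta> by (simp add: top_unique not_less ennreal_mult_top)
  next
    case True
    define X where "X = (\<integral>\<^sup>+ x. epowr (u x) (\<gamma> + q) \<partial>\<sigma>)"
    define f where "f = potential G (density \<sigma> (\<lambda>y. epowr (u y) q))"
    have [measurable]: "f \<in> borel_measurable \<sigma>"
      unfolding f_def by (intro measurable_potential' sets) (simp add: sets)
    have "in_Lp (\<gamma> + q) \<sigma> u"
      using True by (simp add: in_Lp_def)
    then have "in_Lp_loc q \<sigma> u"
      using q \<gamma> by (intro in_Lp_loc_if_in_Lp[OF \<sigma> open_\<Omega>]) auto
    then have uq: "density \<sigma> (\<lambda>y. epowr (u y) q) \<in> \<M>\<^sup>+ \<Omega>"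
      by (rule density_epowr_in_borel_measures[OF \<sigma> open_\<Omega>])
    have "(\<integral>\<^sup>+ x. epowr (f x) (\<gamma> + p) \<partial>\<tau>) \<le>
        B + ennreal (\<delta> / 2) * (\<integral>\<^sup>+ x. epowr (f x) \<gamma> \<partial>density \<sigma> (\<lambda>y. epowr (u y) q))"
      using potential_energy_estimate[OF uq \<tau> p \<gamma> L(1), of top] by (simp add: B_def L(2) f_def)
    also have "(\<integral>\<^sup>+ x. epowr (f x) \<gamma> \<partial>density \<sigma> (\<lambda>y. epowr (u y) q)) \<le> (\<integral>\<^sup>+ x. epowr (f x) (\<gamma> + q) \<partial>\<sigma>) + X"
      using energy_le[OF sets u \<open>f \<in> borel_measurable \<sigma>\<close>, of "\<lambda>_. 1" \<gamma> q] \<gamma> q by (simp add: density_1 X_def)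
    also have "(\<integral>\<^sup>+ x. epowr (f x) (\<gamma> + q) \<partial>\<sigma>) \<le> D + X"
      using D(2)[OF u] by (simp add: f_def X_def)
    finally have "(\<integral>\<^sup>+ x. epowr (f x) (\<gamma> + p) \<partial>\<tau>) \<le> B + ennreal (\<delta> / 2) * (D + X + X)"
      by (simp add: mult_left_mono add_left_mono add_right_mono)
    also have "\<dots> = B + ennreal (\<delta> / 2) * D + (ennreal (\<delta> / 2) + ennreal (\<delta> / 2)) * X"
      by (simp only: distrib_left distrib_right add.assoc)
    also have "ennreal (\<delta> / 2) + ennreal (\<delta> / 2) = ennreal \<delta>"
      using \<delta> by (simp flip: ennreal_plus)
    finally show ?thesis
      by (simp add: f_def X_def)
  qed
  with B D(1) show ?thesis
    by (intro that[of "B + ennreal (\<delta> / 2) * D"]) (auto simp: ennreal_mult_less_top)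
qed

end

section \<open>The sublinear equation\<close>

context wmp_kernel
begin

text \<open>Multiplying \<sigma> by c is compatible with u = \<G>(u^q d\<sigma>) if \<open>u\<close>
  is multiplied by c^(1/(1-q)), which dictates the exponent.\<close>

definition barrier :: "real \<Rightarrow> real \<Rightarrow> 'a measure \<Rightarrow> 'a \<Rightarrow> ennreal" where
  "barrier \<kappa> q \<sigma> x = ennreal \<kappa> * epowr (potential G \<sigma> x) (1 / (1 - q))"

lemma measurable_barrier:
  assumes "sets \<sigma> = sets \<B>"
  shows "barrier \<kappa> q \<sigma> \<in> borel_measurable \<sigma>"
  unfolding barrier_def using measurable_potential'[OF assms assms] by measurable

lemma epowr_barrier:
  "0 < \<kappa> \<Longrightarrow> epowr (barrier \<kappa> q \<sigma> x) p = ennreal (\<kappa> powr p) * epowr (potential G \<sigma> x) (p / (1 - q))"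
  by (simp add: barrier_def epowr_mult epowr_epowr epowr_ennreal)

text \<open>The lower bound inverts \<open>potential_le_supersolution\<close>, and the subsolution
  property is \<open>epowr_potential_le\<close> at p = q/(1-q), whose constant is \<open>d\<close>.
  Both persist when \<kappa> is decreased, the second because q < 1, so one \<kappa> serves
  both.\<close>

lemma ex_barrier:
  fixes q :: real
  assumes q: "0 < q" "q < 1"
  obtains \<kappa> where "0 < \<kappa>"
    "\<And>\<sigma> u x. \<sigma> \<in> \<M>\<^sup>+ \<Omega> \<Longrightarrow> in_Lp_loc q \<sigma> u \<Longrightarrow> (\<And>x. x \<in> \<Omega> \<Longrightarrow> 0 < u x) \<Longrightarrow>
       (\<And>x. x \<in> \<Omega> \<Longrightarrow> potential G (density \<sigma> (\<lambda>y. epowr (u y) q)) x \<le> u x) \<Longrightarrow> x \<in> \<Omega> \<Longrightarrow>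
       barrier \<kappa> q \<sigma> x \<le> u x"
    "\<And>\<sigma> x. \<sigma> \<in> \<M>\<^sup>+ \<Omega> \<Longrightarrow> x \<in> \<Omega> \<Longrightarrow>
       barrier \<kappa> q \<sigma> x \<le> potential G (density \<sigma> (\<lambda>y. epowr (barrier \<kappa> q \<sigma> y) q)) x"
proof -
  obtain C where C: "0 < C"
    "\<And>\<sigma> u x. \<sigma> \<in> \<M>\<^sup>+ \<Omega> \<Longrightarrow> in_Lp_loc q \<sigma> u \<Longrightarrow> (\<And>x. x \<in> \<Omega> \<Longrightarrow> 0 < u x) \<Longrightarrow>
       (\<And>x. x \<in> \<Omega> \<Longrightarrow> potential G (density \<sigma> (\<lambda>y. epowr (u y) q)) x \<le> u x) \<Longrightarrow> x \<in> \<Omega> \<Longrightarrow>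
       potential G \<sigma> x \<le> ennreal C * epowr (u x) (1 - q)"
    using potential_le_supersolution[OF q] by blast
  define d where "d = (1 / (2 * h)) powr (q / (1 - q)) / 2"
  have d: "0 < d"
    using h_ge_1 by (simp add: d_def)
  \<comment> \<open>The first entry gives \<kappa> C^(1/(1-q)) \<le> 1, the second \<kappa>^(1-q)
    \<le> d, that is, \<kappa> \<le> \<kappa>^q d.\<close>
  define \<kappa> where "\<kappa> = min ((1 / C) powr (1 / (1 - q))) (d powr (1 / (1 - q)))"
  have \<kappa>: "0 < \<kappa>"
    using C(1) d by (simp add: \<kappa>_def)
  show ?thesis
  proof (rule that[OF \<kappa>])
    fix \<sigma> u x
    assume *: "\<sigma> \<in> \<M>\<^sup>+ \<Omega>" "in_Lp_loc q \<sigma> u" "\<And>x. x \<in> \<Omega> \<Longrightarrow> 0 < u x"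
      "\<And>x. x \<in> \<Omega> \<Longrightarrow> potential G (density \<sigma> (\<lambda>y. epowr (u y) q)) x \<le> u x" "x \<in> \<Omega>"
    have "epowr (potential G \<sigma> x) (1 / (1 - q)) \<le> epowr (ennreal C * epowr (u x) (1 - q)) (1 / (1 - q))"
      using C(2)[OF *] q by (intro epowr_mono) auto
    also have "\<dots> = ennreal (C powr (1 / (1 - q))) * u x"
      using C(1) q by (simp add: epowr_mult epowr_epowr epowr_ennreal)
    finally have "barrier \<kappa> q \<sigma> x \<le> ennreal \<kappa> * (ennreal (C powr (1 / (1 - q))) * u x)"
      unfolding barrier_def by (rule mult_left_mono) simp
    also have "\<dots> = ennreal (\<kappa> * C powr (1 / (1 - q))) * u x"
      using \<kappa> by (simp add: ennreal_mult mult.assoc)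
    also have "\<dots> \<le> 1 * u x"
    proof (rule mult_right_mono)
      have "\<kappa> * C powr (1 / (1 - q)) \<le> (1 / C) powr (1 / (1 - q)) * C powr (1 / (1 - q))"
        by (intro mult_right_mono) (auto simp: \<kappa>_def)
      also have "\<dots> = 1"
        using C(1) by (simp add: powr_mult[symmetric])
      finally show "ennreal (\<kappa> * C powr (1 / (1 - q))) \<le> 1"
        by (simp add: ennreal_le_1)
    qed simp
    finally show "barrier \<kappa> q \<sigma> x \<le> u x"
      by simp
  next
    fix \<sigma> x assume \<sigma>: "\<sigma> \<in> \<M>\<^sup>+ \<Omega>" and x: "x \<in> \<Omega>"
    note sets = borel_measuresD(2)[OF \<sigma>]
    note [measurable] = measurable_potential'[OF sets sets] measurable_kernel[OF sets x]
    have "\<kappa> \<le> d powr (1 / (1 - q))"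
      by (simp add: \<kappa>_def)
    then have "\<kappa> powr (1 - q) \<le> (d powr (1 / (1 - q))) powr (1 - q)"
      using \<kappa> q by (intro powr_mono2) auto
    then have "\<kappa> powr (1 - q) \<le> d"
      using d q by (simp add: powr_powr)
    then have "\<kappa> powr q * \<kappa> powr (1 - q) \<le> \<kappa> powr q * d"
      by (intro mult_left_mono) auto
    then have "\<kappa> \<le> \<kappa> powr q * d"
      using \<kappa> by (simp add: powr_add[symmetric])
    then have "barrier \<kappa> q \<sigma> x \<le> ennreal (\<kappa> powr q * d) * epowr (potential G \<sigma> x) (1 / (1 - q))"
      unfolding barrier_def by (intro mult_right_mono ennreal_leI) auto
    also have "1 / (1 - q) = q / (1 - q) + 1"
      using q by (simp add: field_simps)
    also have "ennreal (\<kappa> powr q * d) * epowr (potential G \<sigma> x) (q / (1 - q) + 1) =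
        ennreal (\<kappa> powr q) * (ennreal d * epowr (potential G \<sigma> x) (q / (1 - q) + 1))"
      using d by (simp add: ennreal_mult mult.assoc)
    also have "\<dots> \<le> ennreal (\<kappa> powr q) * potential G (density \<sigma> (\<lambda>y. epowr (potential G \<sigma> y) (q / (1 - q)))) x"
      unfolding d_def using q by (intro mult_left_mono epowr_potential_le \<sigma> x) auto
    also have "\<dots> = ennreal (\<kappa> powr q) * (\<integral>\<^sup>+ y. epowr (potential G \<sigma> y) (q / (1 - q)) * G x y \<partial>\<sigma>)"
      by (subst potential_density[OF sets _ x]) auto
    also have "\<dots> = (\<integral>\<^sup>+ y. ennreal (\<kappa> powr q) * (epowr (potential G \<sigma> y) (q / (1 - q)) * G x y) \<partial>\<sigma>)"
      by (intro nn_integral_cmult[symmetric]) measurable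
    also have "\<dots> = potential G (density \<sigma> (\<lambda>y. epowr (barrier \<kappa> q \<sigma> y) q)) x"
      using \<kappa> by (subst potential_density[OF sets _ x]) (auto simp: epowr_barrier mult.assoc)
    finally show "barrier \<kappa> q \<sigma> x \<le> potential G (density \<sigma> (\<lambda>y. epowr (barrier \<kappa> q \<sigma> y) q)) x" .
  qed
qed

end

section \<open>Supersolutions of the equation\<close>

locale sublinear_equation = wmp_kernel +
  fixes M :: nat and q :: "nat \<Rightarrow> real" and \<gamma> :: real and \<sigma> :: "nat \<Rightarrow> 'a measure" and \<omega> :: "'a measure"
  assumes q: "\<And>i. i \<in> {1..M} \<Longrightarrow> 0 < q i" "\<And>i. i \<in> {1..M} \<Longrightarrow> q i < 1"
    and \<gamma>: "0 < \<gamma>"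
    and \<sigma>: "\<And>i. i \<in> {1..M} \<Longrightarrow> \<sigma> i \<in> \<M>\<^sup>+ \<Omega>"
    and \<omega>: "\<omega> \<in> \<M>\<^sup>+ \<Omega>"
begin

abbreviation "supersolution \<equiv> is_supersolution \<Omega> G M q \<sigma> \<omega>"

text \<open>Every index has its own function because the iteration starts from a different barrier
  for each measure; a constant family gives the sum in the equation.\<close>

definition sum_potential :: "(nat \<Rightarrow> 'a \<Rightarrow> ennreal) \<Rightarrow> 'a \<Rightarrow> ennreal" where
  "sum_potential w x = (\<Sum>i=1..M. potential G (density (\<sigma> i) (\<lambda>y. epowr (w i y) (q i))) x)"

lemma eq_rhs_eq: "eq_rhs G M q \<sigma> \<omega> u x = sum_potential (\<lambda>_. u) x + potential G \<omega> x"
  by (simp add: eq_rhs_def sum_potential_def)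

lemmas sets_\<sigma> = borel_measuresD(2)[OF \<sigma>]
lemmas space_\<sigma> = borel_measuresD(1)[OF \<sigma>]

lemma measurable_sum_potential: "sum_potential w \<in> borel_measurable \<B>"
  unfolding sum_potential_def by (intro borel_measurable_sum measurable_potential) (simp add: sets_\<sigma>)

lemma measurable_eq_rhs: "eq_rhs G M q \<sigma> \<omega> u \<in> borel_measurable \<B>"
  unfolding eq_rhs_eq[abs_def]
  by (intro borel_measurable_add measurable_sum_potential measurable_potential borel_measuresD(2)[OF \<omega>])

lemma measurable_\<sigma>: "i \<in> {1..M} \<Longrightarrow> f \<in> borel_measurable \<B> \<Longrightarrow> f \<in> borel_measurable (\<sigma> i)"
  by (simp add: measurable_cong_sets[OF sets_\<sigma> refl])

lemma sum_potential_mono: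
  assumes "\<And>i. i \<in> {1..M} \<Longrightarrow> v i \<in> borel_measurable (\<sigma> i)" "\<And>i. i \<in> {1..M} \<Longrightarrow> w i \<in> borel_measurable (\<sigma> i)"
    and "\<And>i y. i \<in> {1..M} \<Longrightarrow> y \<in> \<Omega> \<Longrightarrow> v i y \<le> w i y" and "x \<in> \<Omega>"
  shows "sum_potential v x \<le> sum_potential w x"
  unfolding sum_potential_def using assms q
  by (intro sum_mono potential_mono_density sets_\<sigma> epowr_mono borel_measurable_epowr) (auto simp: less_imp_le)

lemma eq_rhs_mono:
  assumes "v \<in> borel_measurable \<B>" "w \<in> borel_measurable \<B>" "\<And>y. y \<in> \<Omega> \<Longrightarrow> v y \<le> w y" "x \<in> \<Omega>"
  shows "eq_rhs G M q \<sigma> \<omega> v x \<le> eq_rhs G M q \<sigma> \<omega> w x"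
  unfolding eq_rhs_eq using assms by (intro add_right_mono sum_potential_mono measurable_\<sigma>) auto

lemma potential_le_sum_potential:
  "i \<in> {1..M} \<Longrightarrow> potential G (density (\<sigma> i) (\<lambda>y. epowr (w i y) (q i))) x \<le> sum_potential w x"
  unfolding sum_potential_def by (rule member_le_sum) auto

text \<open>Monotone convergence for each potential, after the power has been moved inside the
  supremum; in a finite sum of increasing sequences suprema can be taken termwise.\<close>

lemma eq_rhs_SUP:
  assumes U: "\<And>k. U k \<in> borel_measurable \<B>" "\<And>k x. x \<in> \<Omega> \<Longrightarrow> U k x \<le> U (Suc k) x" and x: "x \<in> \<Omega>"
  shows "eq_rhs G M q \<sigma> \<omega> (\<lambda>x. SUP k. U k x) x = (SUP k::nat. eq_rhs G M q \<sigma> \<omega> (U k) x)"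
proof -
  let ?p = "\<lambda>u i. potential G (density (\<sigma> i) (\<lambda>y. epowr (u y) (q i))) x"
  have meas: "U k \<in> borel_measurable (\<sigma> i)" "(\<lambda>x. SUP k. U k x) \<in> borel_measurable (\<sigma> i)" if "i \<in> {1..M}" for i k
    using U(1) that by (auto intro!: measurable_\<sigma> borel_measurable_SUP)
  have "?p (\<lambda>x. SUP k. U k x) i = (SUP k. ?p (U k) i)" if i: "i \<in> {1..M}" for i
  proof -
    note [measurable] = measurable_kernel[OF sets_\<sigma>[OF i] x] meas[OF i]
    have "?p (\<lambda>x. SUP k. U k x) i = (\<integral>\<^sup>+ y. (SUP k. epowr (U k y) (q i) * G x y) \<partial>\<sigma> i)"
      by (subst potential_density[OF sets_\<sigma>[OF i] _ x])
        (auto simp: epowr_SUP[OF q(1)[OF i]] SUP_mult_right_ennreal intro!: borel_measurable_epowr)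
    also have "\<dots> = (SUP k. \<integral>\<^sup>+ y. epowr (U k y) (q i) * G x y \<partial>\<sigma> i)"
    proof (rule nn_integral_monotone_convergence_SUP_AE)
      show "AE y in \<sigma> i. epowr (U k y) (q i) * G x y \<le> epowr (U (Suc k) y) (q i) * G x y" for k
        using U(2) q(1)[OF i] by (intro AE_I2 mult_right_mono epowr_mono) (auto simp: space_\<sigma>[OF i])
    qed measurable
    also have "\<dots> = (SUP k. ?p (U k) i)"
      by (subst potential_density[OF sets_\<sigma>[OF i] _ x]) auto
    finally show ?thesis .
  qed
  then have "eq_rhs G M q \<sigma> \<omega> (\<lambda>x. SUP k. U k x) x = (\<Sum>i=1..M. SUP k. ?p (U k) i) + potential G \<omega> x"
    by (simp add: eq_rhs_def)
  also have "(\<Sum>i=1..M. SUP k. ?p (U k) i) = (SUP k. \<Sum>i=1..M. ?p (U k) i)"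
  proof (rule ennreal_SUP_sum[symmetric])
    fix i assume i: "i \<in> {1..M}"
    show "incseq (\<lambda>k. ?p (U k) i)"
      using U(2) x meas[OF i] q(1)[OF i]
      by (intro incseq_SucI potential_mono_density sets_\<sigma>[OF i] borel_measurable_epowr epowr_mono) auto
  qed
  also have "\<dots> + potential G \<omega> x = (SUP k. eq_rhs G M q \<sigma> \<omega> (U k) x)"
    unfolding eq_rhs_def by (rule ennreal_SUP_add_left[symmetric]) simp
  finally show ?thesis .
qed

lemma supersolutionD:
  assumes "supersolution u"
  shows "u \<in> borel_measurable \<B>" "\<And>i. i \<in> {1..M} \<Longrightarrow> in_Lp_loc (q i) (\<sigma> i) u"
    "\<And>x. x \<in> \<Omega> \<Longrightarrow> eq_rhs G M q \<sigma> \<omega> u x \<le> u x"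
    "\<And>x. x \<in> \<Omega> \<Longrightarrow> potential G \<omega> x \<le> u x"
    "\<And>x. x \<in> \<Omega> \<Longrightarrow> sum_potential (\<lambda>_. u) x \<le> u x"
    "\<And>i x. i \<in> {1..M} \<Longrightarrow> x \<in> \<Omega> \<Longrightarrow> potential G (density (\<sigma> i) (\<lambda>y. epowr (u y) (q i))) x \<le> u x"
proof -
  show 1: "u \<in> borel_measurable \<B>" "\<And>i. i \<in> {1..M} \<Longrightarrow> in_Lp_loc (q i) (\<sigma> i) u"
    "\<And>x. x \<in> \<Omega> \<Longrightarrow> eq_rhs G M q \<sigma> \<omega> u x \<le> u x"
    using assms by (auto simp: is_supersolution_def)
  show "potential G \<omega> x \<le> u x" if "x \<in> \<Omega>" for x
    using 1(3)[OF that] unfolding eq_rhs_eq by (rule order_trans[rotated]) (simp add: add_increasing)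
  show 2: "sum_potential (\<lambda>_. u) x \<le> u x" if "x \<in> \<Omega>" for x
    using 1(3)[OF that] unfolding eq_rhs_eq by (rule order_trans[rotated]) (simp add: add_increasing2)
  show "potential G (density (\<sigma> i) (\<lambda>y. epowr (u y) (q i))) x \<le> u x" if "i \<in> {1..M}" "x \<in> \<Omega>" for i x
    using potential_le_sum_potential[OF that(1), of "\<lambda>_. u" x] 2[OF that(2)] by simp
qed

text \<open>The potential of \<omega> lies below \<open>u\<close>, and so does the barrier, whose
  power \<gamma> + q_i is a multiple of the integrand in the first condition.\<close>

lemma supersolution_imp_conditions:
  assumes u: "supersolution u" "\<And>x. x \<in> \<Omega> \<Longrightarrow> 0 < u x" and i: "i \<in> {1..M}"
    and Lp: "in_Lp (\<gamma> + q i) (\<sigma> i) u"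
  shows "in_Lp ((\<gamma> + q i) / (1 - q i)) (\<sigma> i) (potential G (\<sigma> i))" "in_Lp (\<gamma> + q i) (\<sigma> i) (potential G \<omega>)"
proof -
  define r where "r = \<gamma> + q i"
  have r: "0 < r"
    using \<gamma> q(1)[OF i] by (simp add: r_def)
  have fin: "(\<integral>\<^sup>+ x. epowr (u x) r \<partial>\<sigma> i) < \<infinity>"
    using Lp by (simp add: in_Lp_def r_def)
  have [measurable]: "u \<in> borel_measurable (\<sigma> i)" "potential G (\<sigma> i) \<in> borel_measurable (\<sigma> i)"
    "potential G \<omega> \<in> borel_measurable (\<sigma> i)"
    using measurable_\<sigma>[OF i supersolutionD(1)[OF u(1)]] measurable_potential'[OF _ sets_\<sigma>[OF i]]
      sets_\<sigma>[OF i] borel_measuresD(2)[OF \<omega>] by auto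
  have "(\<integral>\<^sup>+ x. epowr (potential G \<omega> x) r \<partial>\<sigma> i) \<le> (\<integral>\<^sup>+ x. epowr (u x) r \<partial>\<sigma> i)"
    using r supersolutionD(4)[OF u(1)] by (intro nn_integral_mono epowr_mono) (auto simp: space_\<sigma>[OF i])
  with fin show "in_Lp (\<gamma> + q i) (\<sigma> i) (potential G \<omega>)"
    by (auto simp: in_Lp_def r_def)
  obtain \<kappa> where \<kappa>: "0 < \<kappa>" "\<And>x. x \<in> \<Omega> \<Longrightarrow> barrier \<kappa> (q i) (\<sigma> i) x \<le> u x"
    using ex_barrier[OF q(1,2)[OF i]] \<sigma>[OF i] supersolutionD(2,6)[OF u(1) i] u(2) by metis
  have "ennreal (\<kappa> powr r) * (\<integral>\<^sup>+ x. epowr (potential G (\<sigma> i) x) (r / (1 - q i)) \<partial>\<sigma> i) =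
      (\<integral>\<^sup>+ x. epowr (barrier \<kappa> (q i) (\<sigma> i) x) r \<partial>\<sigma> i)"
    by (simp add: epowr_barrier[OF \<kappa>(1)] nn_integral_cmult)
  also have "\<dots> \<le> (\<integral>\<^sup>+ x. epowr (u x) r \<partial>\<sigma> i)"
    using r \<kappa>(2) by (intro nn_integral_mono epowr_mono) (auto simp: space_\<sigma>[OF i])
  also note fin
  finally have "(\<integral>\<^sup>+ x. epowr (potential G (\<sigma> i) x) (r / (1 - q i)) \<partial>\<sigma> i) < \<infinity>"
    using \<kappa>(1) by (auto simp: ennreal_mult_less_top)
  then show "in_Lp ((\<gamma> + q i) / (1 - q i)) (\<sigma> i) (potential G (\<sigma> i))"
    by (simp add: in_Lp_def r_def)
qed

text \<open>If \<open>v\<close> is not almost everywhere zero for some \<open>\<sigma> i\<close> or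
  for \<omega>, positivity of the kernel makes the corresponding potential positive at every point,
  and it lies below \<open>v\<close>.\<close>

lemma nontrivial_supersolution_pos:
  assumes v: "supersolution v" "nontrivial M \<sigma> \<omega> v" and x: "x \<in> \<Omega>"
  shows "0 < v x"
proof -
  consider i where "i \<in> {1..M}" "\<not> (AE y in \<sigma> i. v y = 0)" | "\<not> (AE y in \<omega>. v y = 0)"
    using v(2) by (auto simp: nontrivial_def)
  then show ?thesis
  proof cases
    case 1
    have "v \<in> borel_measurable (\<sigma> i)"
      by (rule measurable_\<sigma>[OF 1(1) supersolutionD(1)[OF v(1)]])
    moreover have "epowr (v y) (q i) = 0 \<longleftrightarrow> v y = 0" for y
      using epowr_pos_iff[of "v y" "q i"] by (simp only: zero_less_iff_neq_zero) blast
    ultimately have "0 < potential G (density (\<sigma> i) (\<lambda>y. epowr (v y) (q i))) x"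
      using 1 x by (intro potential_density_pos sets_\<sigma>) auto
    also have "\<dots> \<le> v x"
      by (rule supersolutionD(6)[OF v(1) 1(1) x])
    finally show ?thesis .
  next
    case 2
    have "emeasure \<omega> \<Omega> \<noteq> 0"
    proof
      assume "emeasure \<omega> \<Omega> = 0"
      then have "space \<omega> \<in> null_sets \<omega>"
        using borel_measuresD(1)[OF \<omega>] by auto
      then have "AE y in \<omega>. v y = 0"
        by (rule AE_I') auto
      with 2 show False by simp
    qed
    then have "0 < potential G \<omega> x"
      by (intro potential_pos borel_measuresD(2)[OF \<omega>] x)
    also have "\<dots> \<le> v x"
      by (rule supersolutionD(4)[OF v(1) x])
    finally show ?thesis .
  qed
qed

end

section \<open>Monotone iteration and the minimal solution\<close>

locale quasi_symmetric_equation =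
  sublinear_equation \<Omega> G h M q \<gamma> \<sigma> \<omega> + quasi_symmetric_wmp_kernel \<Omega> G h a
  for \<Omega> :: "'a::euclidean_space set" and G h M q \<gamma> \<sigma> \<omega> a +
  assumes A: "\<And>i. i \<in> {1..M} \<Longrightarrow> in_Lp ((\<gamma> + q i) / (1 - q i)) (\<sigma> i) (potential G (\<sigma> i))"
    and B: "\<And>i. i \<in> {1..M} \<Longrightarrow> in_Lp (\<gamma> + q i) (\<sigma> i) (potential G \<omega>)"
begin

text \<open>The energies are added up because each potential is integrated against every measure,
  which couples them. A family is taken so that the barriers can be inserted too.\<close>

definition total :: "(nat \<Rightarrow> 'a \<Rightarrow> ennreal) \<Rightarrow> ennreal" where
  "total w = (\<Sum>i=1..M. \<integral>\<^sup>+ x. epowr (w i x) (\<gamma> + q i) \<partial>\<sigma> i)"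

text \<open>\<open>potential_Lp\<close> is applied to every pair of measures, and the power of the
  sum of \<open>M\<close> potentials is split by \<open>epowr_sum_le\<close>.\<close>

lemma total_sum_potential:
  assumes "0 < \<delta>"
  obtains C where "C < top"
    "\<And>w. (\<And>i. i \<in> {1..M} \<Longrightarrow> w i \<in> borel_measurable (\<sigma> i)) \<Longrightarrow>
      total (\<lambda>_. sum_potential w) \<le> C + ennreal \<delta> * total w"
proof -
  \<comment> \<open>\<open>m\<close> dominates the total of the constants from splitting the sum,
    and the coefficient \<delta> / m compensates for it; the 1 keeps \<open>m\<close>
    positive.\<close>
  define m where "m = (\<Sum>i=1..M. real M powr (\<gamma> + q i)) + 1"
  have m: "0 < m"
    unfolding m_def by (intro add_nonneg_pos sum_nonneg) auto
  let ?f = "\<lambda>w j. potential G (density (\<sigma> j) (\<lambda>y. epowr (w y) (q j)))"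
  have "\<forall>i\<in>{1..M}. \<forall>j\<in>{1..M}. \<exists>C<top. \<forall>u \<in> borel_measurable (\<sigma> j).
      (\<integral>\<^sup>+ x. epowr (?f u j x) (\<gamma> + q i) \<partial>\<sigma> i) \<le> C + ennreal (\<delta> / m) * (\<integral>\<^sup>+ x. epowr (u x) (\<gamma> + q j) \<partial>\<sigma> j)"
  proof (intro ballI)
    fix i j assume i: "i \<in> {1..M}" and j: "j \<in> {1..M}"
    have "0 < \<delta> / m"
      using m assms by simp
    from potential_Lp[OF \<sigma>[OF j] q[OF j] \<gamma> this A[OF j] \<sigma>[OF i] q[OF i] A[OF i]]
    show "\<exists>C<top. \<forall>u \<in> borel_measurable (\<sigma> j). (\<integral>\<^sup>+ x. epowr (?f u j x) (\<gamma> + q i) \<partial>\<sigma> i) \<le>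
        C + ennreal (\<delta> / m) * (\<integral>\<^sup>+ x. epowr (u x) (\<gamma> + q j) \<partial>\<sigma> j)"
      by metis
  qed
  then obtain C where C: "\<And>i j. i \<in> {1..M} \<Longrightarrow> j \<in> {1..M} \<Longrightarrow> C i j < top"
    "\<And>i j u. i \<in> {1..M} \<Longrightarrow> j \<in> {1..M} \<Longrightarrow> u \<in> borel_measurable (\<sigma> j) \<Longrightarrow>
      (\<integral>\<^sup>+ x. epowr (?f u j x) (\<gamma> + q i) \<partial>\<sigma> i) \<le> C i j + ennreal (\<delta> / m) * (\<integral>\<^sup>+ x. epowr (u x) (\<gamma> + q j) \<partial>\<sigma> j)"
    by metis
  define D where "D = (\<Sum>i=1..M. ennreal (real M powr (\<gamma> + q i)) * (\<Sum>j=1..M. C i j))"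
  show ?thesis
  proof (rule that)
    show "D < top"
      using C(1) by (auto simp: D_def ennreal_mult_less_top)
    fix w :: "nat \<Rightarrow> 'a \<Rightarrow> ennreal"
    assume w: "\<And>i. i \<in> {1..M} \<Longrightarrow> w i \<in> borel_measurable (\<sigma> i)"
    have "total (\<lambda>_. sum_potential w) \<le>
        (\<Sum>i=1..M. ennreal (real M powr (\<gamma> + q i)) * ((\<Sum>j=1..M. C i j) + ennreal (\<delta> / m) * total w))"
      unfolding total_def
    proof (rule sum_mono)
      fix i assume i: "i \<in> {1..M}"
      have meas: "?f (w j) j \<in> borel_measurable (\<sigma> i)" if "j \<in> {1..M}" for j
        using that i by (intro measurable_potential' sets_\<sigma>) (simp add: sets_\<sigma>)
      have "(\<integral>\<^sup>+ x. epowr (sum_potential w x) (\<gamma> + q i) \<partial>\<sigma> i) \<le>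
          (\<integral>\<^sup>+ x. ennreal (real M powr (\<gamma> + q i)) * (\<Sum>j=1..M. epowr (?f (w j) j x) (\<gamma> + q i)) \<partial>\<sigma> i)"
        unfolding sum_potential_def using epowr_sum_le[of "{1..M}" "\<gamma> + q i"] \<gamma> q(1)[OF i]
        by (intro nn_integral_mono) auto
      also have "\<dots> = ennreal (real M powr (\<gamma> + q i)) * (\<Sum>j=1..M. \<integral>\<^sup>+ x. epowr (?f (w j) j x) (\<gamma> + q i) \<partial>\<sigma> i)"
      proof -
        have "(\<integral>\<^sup>+ x. (\<Sum>j=1..M. epowr (?f (w j) j x) (\<gamma> + q i)) \<partial>\<sigma> i) =
            (\<Sum>j=1..M. \<integral>\<^sup>+ x. epowr (?f (w j) j x) (\<gamma> + q i) \<partial>\<sigma> i)"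
          using meas by (intro nn_integral_sum borel_measurable_epowr)
        then show ?thesis
          using meas by (subst nn_integral_cmult) (auto intro!: borel_measurable_sum borel_measurable_epowr)
      qed
      also have "\<dots> \<le> ennreal (real M powr (\<gamma> + q i)) *
          (\<Sum>j=1..M. C i j + ennreal (\<delta> / m) * (\<integral>\<^sup>+ x. epowr (w j x) (\<gamma> + q j) \<partial>\<sigma> j))"
        using C(2)[OF i] w by (intro mult_left_mono sum_mono) auto
      also have "\<dots> = ennreal (real M powr (\<gamma> + q i)) * ((\<Sum>j=1..M. C i j) + ennreal (\<delta> / m) *
          (\<Sum>j=1..M. \<integral>\<^sup>+ x. epowr (w j x) (\<gamma> + q j) \<partial>\<sigma> j))"
        by (simp add: sum.distrib sum_distrib_left)
      finally show "(\<integral>\<^sup>+ x. epowr (sum_potential w x) (\<gamma> + q i) \<partial>\<sigma> i) \<le> \<dots>" .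
    qed
    also have "\<dots> = D + (\<Sum>i=1..M. ennreal (real M powr (\<gamma> + q i))) * (ennreal (\<delta> / m) * total w)"
      by (simp only: D_def distrib_left sum.distrib sum_distrib_right)
    also have "\<dots> \<le> D + ennreal m * (ennreal (\<delta> / m) * total w)"
      by (intro add_left_mono mult_right_mono) (auto simp: m_def intro!: ennreal_leI)
    also have "ennreal m * (ennreal (\<delta> / m) * total w) = ennreal \<delta> * total w"
      using m assms by (simp add: mult.assoc[symmetric] ennreal_mult[symmetric])
    finally show "total (\<lambda>_. sum_potential w) \<le> D + ennreal \<delta> * total w" .
  qed
qed

text \<open>The coefficient 1/2 is below 1, so a bound on \<open>total\<close> reproduces itself
  under iteration. The potential of \<omega> contributes a constant, finite by
  \<open>B\<close>.\<close>

lemma total_eq_rhs: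
  obtains D where "D < top"
    "\<And>u. u \<in> borel_measurable \<B> \<Longrightarrow>
      total (\<lambda>_. eq_rhs G M q \<sigma> \<omega> u) \<le> D + ennreal (1 / 2) * total (\<lambda>_. u)"
proof -
  define m where "m = (\<Sum>i=1..M. 2 powr (\<gamma> + q i)) + 1"
  have m: "0 < m"
    unfolding m_def by (intro add_nonneg_pos sum_nonneg) auto
  have le_m: "2 powr (\<gamma> + q i) \<le> m" if "i \<in> {1..M}" for i
    using member_le_sum[OF that, of "\<lambda>i. 2 powr (\<gamma> + q i)"] by (simp add: m_def)
  obtain C where C: "C < top"
    "\<And>w. (\<And>i. i \<in> {1..M} \<Longrightarrow> w i \<in> borel_measurable (\<sigma> i)) \<Longrightarrow>
      total (\<lambda>_. sum_potential w) \<le> C + ennreal (1 / (2 * m)) * total w"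
    \<comment> \<open>Splitting off the potential of \<omega> costs a factor at most
      \<open>m\<close>, so 1 / (2 m) leads to 1/2.\<close>
    using total_sum_potential[of "1 / (2 * m)"] m by auto
  have T\<omega>: "total (\<lambda>_. potential G \<omega>) < top"
    using B by (auto simp: total_def in_Lp_def)
  define D where "D = ennreal m * (C + total (\<lambda>_. potential G \<omega>))"
  show ?thesis
  proof (rule that)
    show "D < top"
      using C(1) T\<omega> by (auto simp: D_def ennreal_mult_less_top)
    fix u :: "'a \<Rightarrow> ennreal"
    assume u: "u \<in> borel_measurable \<B>"
    have "total (\<lambda>_. eq_rhs G M q \<sigma> \<omega> u) \<le> (\<Sum>i=1..M. ennreal m *
        ((\<integral>\<^sup>+ x. epowr (sum_potential (\<lambda>_. u) x) (\<gamma> + q i) \<partial>\<sigma> i) + (\<integral>\<^sup>+ x. epowr (potential G \<omega> x) (\<gamma> + q i) \<partial>\<sigma> i)))"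
      unfolding total_def
    proof (rule sum_mono)
      fix i assume i: "i \<in> {1..M}"
      have [measurable]: "sum_potential (\<lambda>_. u) \<in> borel_measurable (\<sigma> i)" "potential G \<omega> \<in> borel_measurable (\<sigma> i)"
        by (intro measurable_\<sigma>[OF i] measurable_sum_potential measurable_potential borel_measuresD(2)[OF \<omega>])+
      have "(\<integral>\<^sup>+ x. epowr (eq_rhs G M q \<sigma> \<omega> u x) (\<gamma> + q i) \<partial>\<sigma> i) \<le> (\<integral>\<^sup>+ x. ennreal m *
          (epowr (sum_potential (\<lambda>_. u) x) (\<gamma> + q i) + epowr (potential G \<omega> x) (\<gamma> + q i)) \<partial>\<sigma> i)"
      proof (rule nn_integral_mono)
        fix x
        have "epowr (eq_rhs G M q \<sigma> \<omega> u x) (\<gamma> + q i) \<le> ennreal (2 powr (\<gamma> + q i)) *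
            (epowr (sum_potential (\<lambda>_. u) x) (\<gamma> + q i) + epowr (potential G \<omega> x) (\<gamma> + q i))"
          unfolding eq_rhs_eq using \<gamma> q(1)[OF i] by (intro epowr_add_le) auto
        also have "\<dots> \<le> ennreal m * (epowr (sum_potential (\<lambda>_. u) x) (\<gamma> + q i) + epowr (potential G \<omega> x) (\<gamma> + q i))"
          using le_m[OF i] by (intro mult_right_mono ennreal_leI) auto
        finally show "epowr (eq_rhs G M q \<sigma> \<omega> u x) (\<gamma> + q i) \<le> \<dots>" .
      qed
      also have "\<dots> = ennreal m * ((\<integral>\<^sup>+ x. epowr (sum_potential (\<lambda>_. u) x) (\<gamma> + q i) \<partial>\<sigma> i) +
          (\<integral>\<^sup>+ x. epowr (potential G \<omega> x) (\<gamma> + q i) \<partial>\<sigma> i))"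
        by (simp add: nn_integral_cmult nn_integral_add)
      finally show "(\<integral>\<^sup>+ x. epowr (eq_rhs G M q \<sigma> \<omega> u x) (\<gamma> + q i) \<partial>\<sigma> i) \<le> \<dots>" .
    qed
    also have "\<dots> = ennreal m * (total (\<lambda>_. sum_potential (\<lambda>_. u)) + total (\<lambda>_. potential G \<omega>))"
      by (simp add: total_def sum.distrib sum_distrib_left[symmetric])
    also have "\<dots> \<le> ennreal m * (C + ennreal (1 / (2 * m)) * total (\<lambda>_. u) + total (\<lambda>_. potential G \<omega>))"
      using C(2)[of "\<lambda>_. u"] measurable_\<sigma> u by (intro mult_left_mono add_right_mono) auto
    also have "\<dots> = D + ennreal m * ennreal (1 / (2 * m)) * total (\<lambda>_. u)"
      by (simp add: D_def distrib_left ac_simps)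
    also have "ennreal m * ennreal (1 / (2 * m)) = ennreal (1 / 2)"
      using m by (simp add: ennreal_mult[symmetric] del: ennreal_half)
    finally show "total (\<lambda>_. eq_rhs G M q \<sigma> \<omega> u) \<le> D + ennreal (1 / 2) * total (\<lambda>_. u)" .
  qed
qed

text \<open>The iteration starts from the potentials of the barriers. It increases because the
  barriers are subsolutions, stays below every nontrivial supersolution because the barriers do, and
  remains bounded in \<open>total\<close>; its supremum is the solution.\<close>

lemma ex_minimal_solution:
  assumes nz: "\<not> ((\<forall>i\<in>{1..M}. \<sigma> i = null_measure \<B>) \<and> \<omega> = null_measure \<B>)"
  shows "\<exists>u. is_solution \<Omega> G M q \<sigma> \<omega> u \<and> (\<forall>x\<in>\<Omega>. 0 < u x) \<and>
    (\<forall>i\<in>{1..M}. in_Lp (\<gamma> + q i) (\<sigma> i) u) \<and>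
    (\<forall>v. supersolution v \<and> nontrivial M \<sigma> \<omega> v \<longrightarrow> (\<forall>x\<in>\<Omega>. u x \<le> v x))"
proof -
  have "\<forall>i\<in>{1..M}. \<exists>\<kappa>>0. (\<forall>u. in_Lp_loc (q i) (\<sigma> i) u \<longrightarrow> (\<forall>x\<in>\<Omega>. 0 < u x) \<longrightarrow>
       (\<forall>x\<in>\<Omega>. potential G (density (\<sigma> i) (\<lambda>y. epowr (u y) (q i))) x \<le> u x) \<longrightarrow>
       (\<forall>x\<in>\<Omega>. barrier \<kappa> (q i) (\<sigma> i) x \<le> u x)) \<and>
     (\<forall>x\<in>\<Omega>. barrier \<kappa> (q i) (\<sigma> i) x \<le> potential G (density (\<sigma> i) (\<lambda>y. epowr (barrier \<kappa> (q i) (\<sigma> i) y) (q i))) x)"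
  proof
    fix i assume i: "i \<in> {1..M}"
    show "\<exists>\<kappa>>0. (\<forall>u. in_Lp_loc (q i) (\<sigma> i) u \<longrightarrow> (\<forall>x\<in>\<Omega>. 0 < u x) \<longrightarrow>
       (\<forall>x\<in>\<Omega>. potential G (density (\<sigma> i) (\<lambda>y. epowr (u y) (q i))) x \<le> u x) \<longrightarrow>
       (\<forall>x\<in>\<Omega>. barrier \<kappa> (q i) (\<sigma> i) x \<le> u x)) \<and>
     (\<forall>x\<in>\<Omega>. barrier \<kappa> (q i) (\<sigma> i) x \<le> potential G (density (\<sigma> i) (\<lambda>y. epowr (barrier \<kappa> (q i) (\<sigma> i) y) (q i))) x)"
      using ex_barrier[OF q[OF i]] \<sigma>[OF i] by metis
  qed
  then obtain \<kappa> where \<kappa>: "\<And>i. i \<in> {1..M} \<Longrightarrow> 0 < \<kappa> i"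
    "\<And>i u x. i \<in> {1..M} \<Longrightarrow> in_Lp_loc (q i) (\<sigma> i) u \<Longrightarrow> (\<And>x. x \<in> \<Omega> \<Longrightarrow> 0 < u x) \<Longrightarrow>
       (\<And>x. x \<in> \<Omega> \<Longrightarrow> potential G (density (\<sigma> i) (\<lambda>y. epowr (u y) (q i))) x \<le> u x) \<Longrightarrow> x \<in> \<Omega> \<Longrightarrow>
       barrier (\<kappa> i) (q i) (\<sigma> i) x \<le> u x"
    "\<And>i x. i \<in> {1..M} \<Longrightarrow> x \<in> \<Omega> \<Longrightarrow> barrier (\<kappa> i) (q i) (\<sigma> i) x \<le>
       potential G (density (\<sigma> i) (\<lambda>y. epowr (barrier (\<kappa> i) (q i) (\<sigma> i) y) (q i))) x"
    unfolding bchoice_iff by blast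
  define w where "w = (\<lambda>i. barrier (\<kappa> i) (q i) (\<sigma> i))"
  have w_meas: "w i \<in> borel_measurable (\<sigma> i)" if "i \<in> {1..M}" for i
    unfolding w_def by (rule measurable_barrier[OF sets_\<sigma>[OF that]])
  \<comment> \<open>Starting from \<open>sum_potential w\<close> combines the barriers into one
    function that lies above each of them.\<close>
  define U where "U k = (eq_rhs G M q \<sigma> \<omega> ^^ k) (sum_potential w)" for k
  have U_Suc: "U (Suc k) = eq_rhs G M q \<sigma> \<omega> (U k)" for k
    by (simp add: U_def)
  have U_meas: "U k \<in> borel_measurable \<B>" for k
    by (cases k) (simp_all add: U_def measurable_sum_potential measurable_eq_rhs)
  have w_le: "w i x \<le> U 0 x" if "i \<in> {1..M}" "x \<in> \<Omega>" for i x
    using \<kappa>(3)[OF that] potential_le_sum_potential[OF that(1), of w x] by (simp add: U_def w_def)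
  have U_mono: "U k x \<le> U (Suc k) x" if "x \<in> \<Omega>" for k x
    using that
  proof (induction k arbitrary: x)
    case 0
    have "sum_potential w x \<le> sum_potential (\<lambda>_. U 0) x"
      using w_meas w_le 0 measurable_\<sigma>[OF _ U_meas] by (intro sum_potential_mono) auto
    then show ?case
      unfolding U_Suc eq_rhs_eq by (simp add: U_def add_increasing2)
  next
    case (Suc k)
    then show ?case
      using eq_rhs_mono[OF U_meas U_meas, of k "Suc k"] by (simp add: U_Suc)
  qed
  define u where "u = (\<lambda>x. SUP k. U k x)"
  have u_meas: "u \<in> borel_measurable \<B>"
    unfolding u_def using U_meas by (intro borel_measurable_SUP) auto
  have U_le_u: "U k x \<le> u x" for k x
    unfolding u_def by (rule SUP_upper) simp
  have u_eq: "u x = eq_rhs G M q \<sigma> \<omega> u x" if x: "x \<in> \<Omega>" for x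
  proof -
    have "eq_rhs G M q \<sigma> \<omega> u x = (SUP k. U (Suc k) x)"
      unfolding u_def U_Suc using U_meas U_mono x by (rule eq_rhs_SUP)
    also have "\<dots> = u x"
    proof (rule antisym)
      show "(SUP k. U (Suc k) x) \<le> u x"
        by (intro SUP_least U_le_u)
      show "u x \<le> (SUP k. U (Suc k) x)"
        unfolding u_def using U_mono[OF x] by (intro SUP_mono) auto
    qed
    finally show ?thesis by simp
  qed
  have u_pos: "0 < u x" if x: "x \<in> \<Omega>" for x
  \<comment> \<open>If \<omega> vanishes, some \<open>\<sigma> i\<close> does not, and its positive
    barrier puts the start of the iteration above 0.\<close>
  proof (cases "\<omega> = null_measure \<B>")
    case True
    with nz obtain i where i: "i \<in> {1..M}" "\<sigma> i \<noteq> null_measure \<B>"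
      by blast
    have "emeasure (\<sigma> i) \<Omega> \<noteq> 0"
      using i(2) null_measure_if_space_null[OF sets_\<sigma>[OF i(1)]] space_\<sigma>[OF i(1)] by auto
    then have "0 < potential G (\<sigma> i) x"
      by (intro potential_pos sets_\<sigma> i(1) x)
    then have "0 < w i x"
      using \<kappa>(1)[OF i(1)] by (simp add: w_def barrier_def ennreal_zero_less_mult_iff)
    also have "\<dots> \<le> U 0 x"
      by (rule w_le[OF i(1) x])
    also have "\<dots> \<le> u x"
      by (rule U_le_u)
    finally show ?thesis .
  next
    case False
    have "emeasure \<omega> \<Omega> \<noteq> 0"
      using False null_measure_if_space_null[OF borel_measuresD(2)[OF \<omega>]] borel_measuresD(1)[OF \<omega>] by auto
    then have "0 < potential G \<omega> x"
      by (intro potential_pos borel_measuresD(2)[OF \<omega>] x)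
    also have "\<dots> \<le> u x"
      unfolding u_eq[OF x] eq_rhs_eq by (simp add: add_increasing)
    finally show ?thesis .
  qed
  obtain D where D: "D < top" "\<And>u. u \<in> borel_measurable \<B> \<Longrightarrow>
      total (\<lambda>_. eq_rhs G M q \<sigma> \<omega> u) \<le> D + ennreal (1 / 2) * total (\<lambda>_. u)"
    using total_eq_rhs by blast
  \<comment> \<open>The barriers have finite energy by \<open>A\<close>: their power \<gamma> + q_i
    is a multiple of the integrand in that condition.\<close>
  have U0: "total (\<lambda>_. U 0) < top"
  proof -
    obtain C where C: "C < top" "\<And>w. (\<And>i. i \<in> {1..M} \<Longrightarrow> w i \<in> borel_measurable (\<sigma> i)) \<Longrightarrow>
        total (\<lambda>_. sum_potential w) \<le> C + ennreal 1 * total w"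
      using total_sum_potential[OF zero_less_one] by blast
    have "(\<integral>\<^sup>+ x. epowr (w i x) (\<gamma> + q i) \<partial>\<sigma> i) < top" if i: "i \<in> {1..M}" for i
    proof -
      have "(\<lambda>x. epowr (potential G (\<sigma> i) x) ((\<gamma> + q i) / (1 - q i))) \<in> borel_measurable (\<sigma> i)"
        by (intro borel_measurable_epowr measurable_potential' sets_\<sigma>[OF i])
      then show ?thesis
        using A[OF i] by (simp add: w_def epowr_barrier[OF \<kappa>(1)[OF i]] nn_integral_cmult in_Lp_def ennreal_mult_less_top)
    qed
    then have "total w < top"
      by (simp add: total_def)
    with C(1) C(2)[of w] w_meas show ?thesis
      by (auto simp: U_def intro: le_less_trans)
  qed
  \<comment> \<open>With T = \<open>total (\<lambda>_. U 0)\<close>, the bound T + 2 D is preserved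
    by a step: D + (T + 2 D) / 2 \<le> T + 2 D.\<close>
  have U_bound: "total (\<lambda>_. U k) \<le> total (\<lambda>_. U 0) + 2 * D" for k
  proof (induction k)
    case 0
    show ?case by (simp add: add_increasing2)
  next
    case (Suc k)
    have "total (\<lambda>_. U (Suc k)) \<le> D + ennreal (1 / 2) * total (\<lambda>_. U k)"
      unfolding U_Suc by (rule D(2)[OF U_meas])
    also have "\<dots> \<le> D + ennreal (1 / 2) * (total (\<lambda>_. U 0) + 2 * D)"
      by (intro add_left_mono mult_left_mono Suc) simp
    also have "ennreal (1 / 2) * (total (\<lambda>_. U 0) + 2 * D) = ennreal (1 / 2) * total (\<lambda>_. U 0) + D"
    proof -
      have "ennreal (1 / 2) * 2 = 1"
        using ennreal_mult[of "1 / 2" 2] by (simp del: ennreal_half)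
      then show ?thesis
        by (simp add: distrib_left mult.assoc[symmetric] del: ennreal_half)
    qed
    also have "D + (ennreal (1 / 2) * total (\<lambda>_. U 0) + D) = ennreal (1 / 2) * total (\<lambda>_. U 0) + 2 * D"
      by (simp only: mult_2 add_ac)
    also have "\<dots> \<le> 1 * total (\<lambda>_. U 0) + 2 * D"
      by (intro add_right_mono mult_right_mono) (auto simp del: ennreal_half simp: ennreal_le_1)
    finally show ?case by simp
  qed
  have u_Lp: "in_Lp (\<gamma> + q i) (\<sigma> i) u" if i: "i \<in> {1..M}" for i
  proof -
    have r: "0 < \<gamma> + q i"
      using \<gamma> q(1)[OF i] by simp
    have [measurable]: "U k \<in> borel_measurable (\<sigma> i)" for k
      by (rule measurable_\<sigma>[OF i U_meas])
    have "(\<integral>\<^sup>+ x. epowr (u x) (\<gamma> + q i) \<partial>\<sigma> i) = (\<integral>\<^sup>+ x. (SUP k. epowr (U k x) (\<gamma> + q i)) \<partial>\<sigma> i)"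
      unfolding u_def by (simp add: epowr_SUP[OF r])
    also have "\<dots> = (SUP k. \<integral>\<^sup>+ x. epowr (U k x) (\<gamma> + q i) \<partial>\<sigma> i)"
    proof (rule nn_integral_monotone_convergence_SUP_AE)
      show "AE x in \<sigma> i. epowr (U k x) (\<gamma> + q i) \<le> epowr (U (Suc k) x) (\<gamma> + q i)" for k
        using U_mono r by (intro AE_I2 epowr_mono) (auto simp: space_\<sigma>[OF i])
    qed measurable
    also have "\<dots> \<le> total (\<lambda>_. U 0) + 2 * D"
    proof (rule SUP_least)
      fix k
      have "(\<integral>\<^sup>+ x. epowr (U k x) (\<gamma> + q i) \<partial>\<sigma> i) \<le> total (\<lambda>_. U k)"
        unfolding total_def by (rule member_le_sum[OF i]) auto
      with U_bound show "(\<integral>\<^sup>+ x. epowr (U k x) (\<gamma> + q i) \<partial>\<sigma> i) \<le> total (\<lambda>_. U 0) + 2 * D"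
        by (rule order_trans[rotated])
    qed
    also have "\<dots> < \<infinity>"
      using U0 D(1) by (simp add: ennreal_mult_less_top)
    finally show ?thesis
      using measurable_\<sigma>[OF i u_meas] by (simp add: in_Lp_def)
  qed
  have "u x \<le> v x" if v: "supersolution v" "nontrivial M \<sigma> \<omega> v" and x: "x \<in> \<Omega>" for v x
  proof -
    \<comment> \<open>A nontrivial supersolution is positive everywhere, as the lower bound in
      \<open>ex_barrier\<close> requires; the constants \<kappa> were fixed before
      \<open>v\<close>.\<close>
    have w_le_v: "w i y \<le> v y" if "i \<in> {1..M}" "y \<in> \<Omega>" for i y
      unfolding w_def using that
      by (intro \<kappa>(2) supersolutionD(2,6)[OF v(1)] nontrivial_supersolution_pos[OF v])
    have "U k y \<le> v y" if "y \<in> \<Omega>" for k y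
      using that
    proof (induction k arbitrary: y)
      case 0
      have "sum_potential w y \<le> sum_potential (\<lambda>_. v) y"
        using w_meas w_le_v 0 measurable_\<sigma>[OF _ supersolutionD(1)[OF v(1)]]
        by (intro sum_potential_mono) auto
      also have "\<dots> \<le> v y"
        by (rule supersolutionD(5)[OF v(1) 0])
      finally show ?case
        by (simp add: U_def)
    next
      case (Suc k)
      have "U (Suc k) y \<le> eq_rhs G M q \<sigma> \<omega> v y"
        unfolding U_Suc using Suc by (intro eq_rhs_mono U_meas supersolutionD(1)[OF v(1)]) auto
      also have "\<dots> \<le> v y"
        by (rule supersolutionD(3)[OF v(1) Suc.prems])
      finally show ?case .
    qed
    with x show ?thesis
      unfolding u_def by (intro SUP_least) auto
  qed
  moreover have "in_Lp_loc (q i) (\<sigma> i) u" if i: "i \<in> {1..M}" for i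
    using q(1)[OF i] \<gamma> by (intro in_Lp_loc_if_in_Lp[OF \<sigma>[OF i] open_\<Omega> u_Lp[OF i]]) auto
  ultimately show ?thesis
    using u_meas u_eq u_pos u_Lp by (intro exI[of _ u]) (auto simp: is_solution_def)
qed

end

theorem theorem3p2:
  fixes \<Omega> :: "(real ^ 'n) set"
    and M :: nat
    and q :: "nat \<Rightarrow> real"
    and \<gamma> :: real
    and \<sigma> :: "nat \<Rightarrow> (real ^ 'n) measure"
    and \<omega> :: "(real ^ 'n) measure"
    and G :: "real ^ 'n \<Rightarrow> real ^ 'n \<Rightarrow> ennreal"
  assumes "open \<Omega>" and "connected \<Omega>" and "\<Omega> \<noteq> {}"
    and "M \<ge> 1"
    and "\<forall>i\<in>{1..M}. 0 < q i \<and> q i < 1"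
    and "0 < \<gamma>"
    and "\<forall>i\<in>{1..M}. \<sigma> i \<in> \<M>\<^sup>+ \<Omega>"
    and "\<omega> \<in> \<M>\<^sup>+ \<Omega>"
    and "\<not> ((\<forall>i\<in>{1..M}. \<sigma> i = null_measure (restrict_space borel \<Omega>)) \<and>
             \<omega> = null_measure (restrict_space borel \<Omega>))"
    and "\<forall>x\<in>\<Omega>. \<forall>y\<in>\<Omega>. 0 < G x y"
    and "lsc_kernel_on \<Omega> G"
    and "weak_max_principle \<Omega> G"
  shows
    "(quasi_symmetric \<Omega> G \<and>
      (\<forall>i\<in>{1..M}. in_Lp ((\<gamma> + q i) / (1 - q i)) (\<sigma> i) (potential G (\<sigma> i))) \<and>
      (\<forall>i\<in>{1..M}. in_Lp (\<gamma> + q i) (\<sigma> i) (potential G \<omega>))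
      \<longrightarrow> (\<exists>u. is_solution \<Omega> G M q \<sigma> \<omega> u \<and> (\<forall>x\<in>\<Omega>. 0 < u x) \<and>
             (\<forall>i\<in>{1..M}. in_Lp (\<gamma> + q i) (\<sigma> i) u) \<and>
             (\<forall>v. is_supersolution \<Omega> G M q \<sigma> \<omega> v \<and> nontrivial M \<sigma> \<omega> v
                  \<longrightarrow> (\<forall>x\<in>\<Omega>. u x \<le> v x))))
     \<and>
     ((\<exists>u. is_supersolution \<Omega> G M q \<sigma> \<omega> u \<and> (\<forall>x\<in>\<Omega>. 0 < u x) \<and>
           (\<forall>i\<in>{1..M}. in_Lp (\<gamma> + q i) (\<sigma> i) u))
      \<longrightarrow> (\<forall>i\<in>{1..M}. in_Lp ((\<gamma> + q i) / (1 - q i)) (\<sigma> i) (potential G (\<sigma> i))) \<and>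
          (\<forall>i\<in>{1..M}. in_Lp (\<gamma> + q i) (\<sigma> i) (potential G \<omega>)))"
proof -
  obtain h where h: "1 \<le> h" "weak_max_principle_const \<Omega> G h"
    using assms(12) by (auto simp: weak_max_principle_def)
  \<comment> \<open>The converse is proved at this level; the constant of quasi-symmetry enters in a
    second interpretation for existence and minimality.\<close>
  interpret sublinear_equation \<Omega> G h M q \<gamma> \<sigma> \<omega>
    using assms h by unfold_locales auto
  show ?thesis
  proof (intro conjI impI, goal_cases)
    case 1
    then obtain a where a: "0 < a" "\<And>x y. x \<in> \<Omega> \<Longrightarrow> y \<in> \<Omega> \<Longrightarrow> G x y \<le> ennreal a * G y x"
      by (auto simp: quasi_symmetric_def)
    interpret quasi_symmetric_equation \<Omega> G h M q \<gamma> \<sigma> \<omega> a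
      using 1 a by unfold_locales auto
    show ?case
      by (rule ex_minimal_solution[OF assms(9)])
  qed (use supersolution_imp_conditions in blast)+
qed

end
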